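(* Let $\mathcal R$ be a strong CCTRS over $\mathcal F$ and $\upsilon$ a usable replacement map for $\mathcal R$. Then $\mathrm{crc}_{\mathcal R}(n)\le\mathrm{rc}_{\Xi(\mathcal R),\mu\upsilon}(n)$ for all $n\ge0$.
   Context: A CCTRS over $\mathcal F$ is a set $\mathcal R$ of conditional rules each of the form $f(\ell_1,\dots,\ell_n)\to r\Leftarrow a_1\approx b_1,\dots,a_k\approx b_k$ (defined symbols $\mathcal F_{\mathcal D}$ are roots of left-hand sides, others constructors; constructor terms contain only constructors and variables; a basic term is $f(t_1,\dots,t_n)$ with $f$ defined and all $t_i$ constructor terms) where $\ell_1,\dots,\ell_n,b_1,\dots,b_k$ are constructor terms, the terms $f(\ell_1,\dots,\ell_n),b_1,\dots,b_k$ pairwise share no variables, $\mathrm{Var}(r)\subseteq\mathrm{Var}(\ell_1,\dots,\ell_n,b_1,\dots,b_k)$, and $\mathrm{Var}(a_i)\subseteq\mathrm{Var}(\ell_1,\dots,\ell_n,b_1,\dots,b_{i-1})$; write $b_0=f(\ell_1,\dots,\ell_n)$ and $a_{k+1}=r$. $\mathcal R{\restriction}f$ is the set of rules with left-hand root $f$. A strong CCTRS is a CCTRS with each $\mathcal R{\restriction}f$ finite and each $f(\ell_1,\dots,\ell_n)$ and $b_j$ linear. Let $m_f=|\mathcal R{\restriction}f|$ (0 for constructors), with fixed enumeration $\rho^f_1,\dots,\rho^f_{m_f}$. Labeled reduction: $\mathcal G$ consists of the constructors and symbols $f_R$ ($R\subseteq\mathcal R{\restriction}f$, same arity as $f$);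 $\mathrm{label}$ replaces each defined $f$ by $f_{\mathcal R\restriction f}$; $\mathrm{erase}$ removes labels; labeled normal forms are terms over constructors, symbols $f_\emptyset$ and variables. $s\rightharpoonup t$ is defined inductively: either (i, $\bot$-step) there are $p$ and a rule $\rho\colon\ell\to r\Leftarrow c$ with $s|_p=f_R(s_1,\dots,s_n)$, $\rho\in R$, $t=s[f_{R\setminus\{\rho\}}(s_1,\dots,s_n)]_p$, and linear labeled normal forms $u_1,\dots,u_n$ on fresh variables and $\sigma$ with $s|_p=f_R(u_1,\dots,u_n)\sigma$ and $f(\mathrm{erase}(u_1),\dots,\mathrm{erase}(u_n))$ not unifiable with $\ell$; or (ii) there are $p$, $\rho\colon f(\ell_1,\dots,\ell_n)\to r\Leftarrow a_1\approx b_1,\dots,a_k\approx b_k$, $\sigma$, $0\le j\le k$ with $s|_p=f_R(\ell_1\sigma,\dots,\ell_n\sigma)$, $\rho\in R$, $\mathrm{label}(a_i)\sigma\rightharpoonup^*b_i\sigma$ for $1\le i\le j$, and either (successful) $j=k$, $t=s[\mathrm{label}(r)\sigma]_p$, or (failed) $j<k$, $\mathrm{label}(a_{j+1})\sigma\rightharpoonup^*u\tau$ for a linear labeled normal form $u$ with $\mathrm{erase}(u)$ not unifiable with $b_{j+1}$, and $t=s[f_{R\setminus\{\rho\}}(\ell_1\sigma,\dots,\ell_n\sigma)]_p$. A complexity-conscious reduction is a labeled reduction with chosen witnessing condition reductions; its cost is the sum of step costs: a $\bot$-step costs $0$, a successful step $1$ plus the costs of its $k$ condition reductions, a failed step the sum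 of the costs of its $j$ condition reductions and of $\mathrm{label}(a_{j+1})\sigma\rightharpoonup^*u\tau$. $s\rightharpoonup_\rhd t$ if there are $p$, $\rho$ as in (ii), $\sigma$, $0\le j<k$ with $s|_p=f_R(\ell_1\sigma,\dots,\ell_n\sigma)$, $\rho\in R$, $\mathrm{label}(a_i)\sigma\rightharpoonup^*b_i\sigma$ for $i\le j$, $t=\mathrm{label}(a_{j+1})\sigma$; $s\rightharpoonup^\infty$ means an infinite sequence of $\rightharpoonup\cup\rightharpoonup_\rhd$ steps from $s$. For a labeled term $s$, $\mathrm{dh}(s)$ is the maximum of the costs of all complexity-conscious reductions starting from $s$, together with $\infty$ if $s\rightharpoonup^\infty$. $\mathrm{crc}_{\mathcal R}(n)=\max\{\mathrm{dh}(\mathrm{label}(t))\mid t\text{ ground basic},\ |t|\le n\}$, with $|t|$ the number of symbols in $t$. The transformed system: signature $\mathcal H$ with constants $\bot,\top$; every $f\in\mathcal F$ of arity $n$ as a symbol of arity $n+m_f$ with $\mu(f)=\{1,\dots,n\}$; for every defined $f$ of arity $n$, every $\rho^f_i$ with $k>0$ conditions and $1\le j\le k$ a symbol $f_i^j$ of arity $n+m_f+j-1$ with $\mu(f_i^j)=\{n+i+j-1\}$; $\mu(\bot)=\mu(\top)=\emptyset$. For a replacement map $\nu$, a position is $\nu$-active in $t$ if it is $\epsilon$ or $iq$ with $i\in\nu(\mathrm{root}(t))$ and $q$ $\nu$-active in $t|_i$; $\mathrm{Pos}_\nu(t)$ is the set of $\nu$-active positions, and $\to_{\Xi(\mathcal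 R),\nu}$ rewrites only at $\nu$-active positions. $\xi_\star$ ($\star\in\{\bot,\top\}$): identity on variables, homomorphic on constructors, $f(t_1..t_n)\mapsto f(\xi_\star(t_1),\dots,\xi_\star(t_n),\star,\dots,\star)$ ($m_f$ copies) for defined $f$. For a linear constructor term $t$: $\mathrm{AP}(x)=\emptyset$, and $\mathrm{AP}(f(t_1,\dots,t_n))$ consists of $g(x_1,\dots,x_m)$ for every constructor $g\neq f$ of arity $m$, $g(x_1,\dots,x_m,\bot,\dots,\bot)$ for every defined $g$ of arity $m$, and $f(x_1,\dots,x_{i-1},u,x_{i+1},\dots,x_n)$ for $u\in\mathrm{AP}(t_i)$ (fresh distinct $x$'s). Notation: $\langle t_1,\dots,t_n\rangle[u_1,\dots,u_j]_i$ is $t_1,\dots,t_{i-1},u_1,\dots,u_j,t_{i+1},\dots,t_n$. For the $i$-th rule $\rho_i\colon f(\vec\ell)\to r\Leftarrow a_1\approx b_1,\dots,a_k\approx b_k$ of $\mathcal R{\restriction}f$ and fresh distinct $x_1,\dots,x_{m_f},y_1,\dots,y_n$, $\Xi(\mathcal R)$ contains: $(1)$ if $k=0$: $f(\vec\ell,\langle\vec x\rangle[\top]_i)\to\xi_\top(r)$; if $k>0$: $(2)$ $f(\vec\ell,\langle\vec x\rangle[\top]_i)\to f_i^1(\vec\ell,\langle\vec x\rangle[\xi_\top(a_1)]_i)$, $(3)$ $f_i^k(\vec\ell,\langle\vec x\rangle[b_1,\dots,b_k]_i)\to\xi_\top(r)$, $(4)$ for $1\le j<k$: $f_i^j(\vec\ell,\langle\vec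 x\rangle[b_1,\dots,b_j]_i)\to f_i^{j+1}(\vec\ell,\langle\vec x\rangle[b_1,\dots,b_j,\xi_\top(a_{j+1})]_i)$, $(5)$ for $1\le j\le k$ and $v\in\mathrm{AP}(b_j)$: $f_i^j(\vec\ell,\langle\vec x\rangle[b_1,\dots,b_{j-1},v]_i)\to f(\vec\ell,\langle\vec x\rangle[\bot]_i)$; and for any $k$: $(6)$ for $1\le j\le n$, $v\in\mathrm{AP}(\ell_j)$: $f(\langle\vec y\rangle[v]_j,\langle\vec x\rangle[\top]_i)\to f(\langle\vec y\rangle[v]_j,\langle\vec x\rangle[\bot]_i)$. The cost of a $\Xi(\mathcal R)$-reduction is the number of steps with rules of type (1) or (3). For $s\in\mathcal T(\mathcal H)$, $\mathrm{dh}_\nu(s)$ is the maximum cost of a $\to_{\Xi(\mathcal R),\nu}$-reduction from $s$ ($\infty$ if $s$ is non-terminating), and $\mathrm{rc}_{\Xi(\mathcal R),\nu}(n)=\max\{\mathrm{dh}_\nu(s)\mid s\in\mathcal T(\mathcal H)\text{ basic},\ |s|\le n\}$, where basic means the root is $f$ or $f_i^j$ ($f$ defined) and all arguments are built from constructors of $\mathcal F$ and $\bot,\top$, and $|s|$ counts the function symbols of $s$ other than $\top$. A replacement map $\upsilon$ on $\mathcal F$ (assigning to each $n$-ary $f$ a subset of $\{1,\dots,n\}$) is usable for $\mathcal R$ if for every rule $b_0\to a_{k+1}\Leftarrow a_1\approx b_1,\dots,a_k\approx b_k$, all $1\le i\le k+1$ and $p\in\mathrm{Pos}(a_i)$: $p\in\mathrm{Pos}_\upsilon(a_i)$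 whenever either the symbol of $a_i$ at $p$ is defined, or $p$ is a variable position of $a_i$ and there are $0\le j<i$ and $q\in\mathrm{Pos}_\upsilon(b_j)$ with $a_i|_p=b_j|_q$. The replacement map $\mu\upsilon$ on $\mathcal H$ is $\mu\upsilon(f)=\upsilon(f)$ for $f\in\mathcal H\cap\mathcal F$ and $\mu\upsilon(g)=\mu(g)$ for $g\in\mathcal H\setminus\mathcal F$. *)

theory Defs
  imports Main "HOL-Library.Extended_Nat"
begin

datatype ('f, 'v) trm = Var 'v | Fun 'f "('f, 'v) trm list"

fun subst :: "('v \<Rightarrow> ('f, 'w) trm) \<Rightarrow> ('f, 'v) trm \<Rightarrow> ('f, 'w) trm" where
  "subst \<sigma> (Var x) = \<sigma> x"
| "subst \<sigma> (Fun f ts) = Fun f (map (subst \<sigma>) ts)"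

fun vars_list :: "('f, 'v) trm \<Rightarrow> 'v list" where
  "vars_list (Var x) = [x]"
| "vars_list (Fun f ts) = concat (map vars_list ts)"

definition vars :: "('f, 'v) trm \<Rightarrow> 'v set" where
  "vars t = set (vars_list t)"

definition linear :: "('f, 'v) trm \<Rightarrow> bool" where
  "linear t = distinct (vars_list t)"

definition ground :: "('f, 'v) trm \<Rightarrow> bool" where
  "ground t = (vars t = {})"

fun funs :: "('f, 'v) trm \<Rightarrow> 'f set" where
  "funs (Var x) = {}"
| "funs (Fun f ts) = insert f (\<Union> (set (map funs ts)))"

fun root :: "('f, 'v) trm \<Rightarrow> 'f option" where
  "root (Var x) = None"
| "root (Fun f ts) = Some f"

text \<open>Well-formedness w.r.t. an arity function (the signature is the whole type of symbols).\<close>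
fun wf :: "('f \<Rightarrow> nat) \<Rightarrow> ('f, 'v) trm \<Rightarrow> bool" where
  "wf ar (Var x) = True"
| "wf ar (Fun f ts) = (length ts = ar f \<and> (\<forall>t\<in>set ts. wf ar t))"

text \<open>Number of symbols (variables count 1; only used on ground terms).\<close>
fun tsize :: "('f, 'v) trm \<Rightarrow> nat" where
  "tsize (Var x) = 1"
| "tsize (Fun f ts) = Suc (sum_list (map tsize ts))"

text \<open>Positions are 1-based argument indices, as in the paper.\<close>
fun subt_at :: "('f, 'v) trm \<Rightarrow> nat list \<Rightarrow> ('f, 'v) trm option" where
  "subt_at t [] = Some t"
| "subt_at (Var x) (i # p) = None"
| "subt_at (Fun f ts) (i # p) =
     (if 1 \<le> i \<and> i \<le> length ts then subt_at (ts ! (i - 1)) p else None)"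

definition poss :: "('f, 'v) trm \<Rightarrow> nat list set" where
  "poss t = {p. subt_at t p \<noteq> None}"

definition subt :: "('f, 'v) trm \<Rightarrow> nat list \<Rightarrow> ('f, 'v) trm" where
  "subt t p = the (subt_at t p)"

fun replace_at :: "('f, 'v) trm \<Rightarrow> nat list \<Rightarrow> ('f, 'v) trm \<Rightarrow> ('f, 'v) trm" where
  "replace_at t [] s = s"
| "replace_at (Var x) (i # p) s = Var x"
| "replace_at (Fun f ts) (i # p) s = Fun f (ts[i - 1 := replace_at (ts ! (i - 1)) p s])"

fun active :: "('f \<Rightarrow> nat set) \<Rightarrow> ('f, 'v) trm \<Rightarrow> nat list \<Rightarrow> bool" where
  "active \<nu> t [] = True"
| "active \<nu> (Var x) (i # p) = False"
| "active \<nu> (Fun f ts) (i # p) =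
     (i \<in> \<nu> f \<and> 1 \<le> i \<and> i \<le> length ts \<and> active \<nu> (ts ! (i - 1)) p)"

text \<open>Unifiability after renaming apart (the variables of the two terms are treated as disjoint).\<close>
definition unifiable :: "('f, 'v) trm \<Rightarrow> ('f, 'v) trm \<Rightarrow> bool" where
  "unifiable s t = (\<exists>\<sigma> \<tau> :: 'v \<Rightarrow> ('f, 'v) trm. subst \<sigma> s = subst \<tau> t)"

datatype ('f, 'v) crule =
  CRule (lhs: "('f, 'v) trm") (rhs: "('f, 'v) trm") (conds: "(('f, 'v) trm \<times> ('f, 'v) trm) list")

definition defs :: "('f, 'v) crule set \<Rightarrow> 'f set" where
  "defs R = {f. \<exists>\<rho>\<in>R. root (lhs \<rho>) = Some f}"

definition restr :: "('f, 'v) crule set \<Rightarrow> 'f \<Rightarrow> ('f, 'v) crule set" where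
  "restr R f = {\<rho>\<in>R. root (lhs \<rho>) = Some f}"

definition constr_term :: "('f, 'v) crule set \<Rightarrow> ('f, 'v) trm \<Rightarrow> bool" where
  "constr_term R t = (\<forall>g\<in>funs t. g \<notin> defs R)"

definition pairwise_var_disjoint :: "('f, 'v) trm list \<Rightarrow> bool" where
  "pairwise_var_disjoint ts =
     (\<forall>i j. i < length ts \<and> j < length ts \<and> i \<noteq> j \<longrightarrow> vars (ts ! i) \<inter> vars (ts ! j) = {})"

definition cctrs :: "('f \<Rightarrow> nat) \<Rightarrow> ('f, 'v) crule set \<Rightarrow> bool" where
  "cctrs ar R = (\<forall>\<rho>\<in>R. \<exists>f ls. lhs \<rho> = Fun f ls \<and>
      wf ar (lhs \<rho>) \<and> wf ar (rhs \<rho>) \<and> (\<forall>(a, b)\<in>set (conds \<rho>). wf ar a \<and> wf ar b) \<and>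
      (\<forall>l\<in>set ls. constr_term R l) \<and>
      (\<forall>(a, b)\<in>set (conds \<rho>). constr_term R b) \<and>
      pairwise_var_disjoint (lhs \<rho> # map snd (conds \<rho>)) \<and>
      vars (rhs \<rho>) \<subseteq> vars (lhs \<rho>) \<union> (\<Union>(a, b)\<in>set (conds \<rho>). vars b) \<and>
      (\<forall>i < length (conds \<rho>). vars (fst (conds \<rho> ! i)) \<subseteq>
          vars (lhs \<rho>) \<union> (\<Union>j\<in>{j. j < i}. vars (snd (conds \<rho> ! j)))))"

definition strong_cctrs :: "('f \<Rightarrow> nat) \<Rightarrow> ('f, 'v) crule set \<Rightarrow> bool" where
  "strong_cctrs ar R = (cctrs ar R \<and> (\<forall>f. finite (restr R f)) \<and>
      (\<forall>\<rho>\<in>R. linear (lhs \<rho>) \<and> (\<forall>(a, b)\<in>set (conds \<rho>). linear b)))"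

definition mR :: "('f, 'v) crule set \<Rightarrow> 'f \<Rightarrow> nat" where
  "mR R f = card (restr R f)"

datatype ('f, 'v) lsym = LC 'f | LD 'f "('f, 'v) crule set"

type_synonym ('f, 'v) ltrm = "(('f, 'v) lsym, 'v) trm"

fun label :: "('f, 'v) crule set \<Rightarrow> ('f, 'v) trm \<Rightarrow> ('f, 'v) ltrm" where
  "label R (Var x) = Var x"
| "label R (Fun f ts) =
     Fun (if f \<in> defs R then LD f (restr R f) else LC f) (map (label R) ts)"

fun esym :: "('f, 'v) lsym \<Rightarrow> 'f" where
  "esym (LC f) = f"
| "esym (LD f S) = f"

fun erase :: "('f, 'v) ltrm \<Rightarrow> ('f, 'v) trm" where
  "erase (Var x) = Var x"
| "erase (Fun g ts) = Fun (esym g) (map erase ts)"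

definition lnf :: "('f, 'v) crule set \<Rightarrow> ('f, 'v) ltrm \<Rightarrow> bool" where
  "lnf R t = (\<forall>g\<in>funs t. (\<exists>c. g = LC c \<and> c \<notin> defs R) \<or> (\<exists>f. g = LD f {} \<and> f \<in> defs R))"

inductive ccstep :: "('f, 'v) crule set \<Rightarrow> ('f, 'v) ltrm \<Rightarrow> ('f, 'v) ltrm \<Rightarrow> nat \<Rightarrow> bool"
  and ccsteps :: "('f, 'v) crule set \<Rightarrow> ('f, 'v) ltrm \<Rightarrow> ('f, 'v) ltrm \<Rightarrow> nat \<Rightarrow> bool"
  for R :: "('f, 'v) crule set" where
  bot: "\<lbrakk> p \<in> poss s; subt s p = Fun (LD f Rl) ss; \<rho> \<in> Rl; lhs \<rho> = Fun f ls;
          length us = length ss; \<forall>u\<in>set us. lnf R u; distinct (concat (map vars_list us));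
          ss = map (subst \<sigma>) us; \<not> unifiable (Fun f (map erase us)) (lhs \<rho>) \<rbrakk>
        \<Longrightarrow> ccstep R s (replace_at s p (Fun (LD f (Rl - {\<rho>})) ss)) 0"
| succ: "\<lbrakk> p \<in> poss s; subt s p = Fun (LD f Rl) (map (\<lambda>l. subst \<sigma> (label R l)) ls);
           \<rho> \<in> Rl; lhs \<rho> = Fun f ls; length cs = length (conds \<rho>);
           \<forall>i < length (conds \<rho>). ccsteps R (subst \<sigma> (label R (fst (conds \<rho> ! i))))
                                          (subst \<sigma> (label R (snd (conds \<rho> ! i)))) (cs ! i) \<rbrakk>
        \<Longrightarrow> ccstep R s (replace_at s p (subst \<sigma> (label R (rhs \<rho>)))) (Suc (sum_list cs))"
| fail: "\<lbrakk> p \<in> poss s; subt s p = Fun (LD f Rl) (map (\<lambda>l. subst \<sigma> (label R l)) ls);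
           \<rho> \<in> Rl; lhs \<rho> = Fun f ls; j < length (conds \<rho>); length cs = j;
           \<forall>i < j. ccsteps R (subst \<sigma> (label R (fst (conds \<rho> ! i))))
                             (subst \<sigma> (label R (snd (conds \<rho> ! i)))) (cs ! i);
           ccsteps R (subst \<sigma> (label R (fst (conds \<rho> ! j)))) (subst \<tau> u) c;
           linear u; lnf R u; \<not> unifiable (erase u) (snd (conds \<rho> ! j)) \<rbrakk>
        \<Longrightarrow> ccstep R s (replace_at s p (Fun (LD f (Rl - {\<rho>})) (map (\<lambda>l. subst \<sigma> (label R l)) ls)))
              (sum_list cs + c)"
| refl: "ccsteps R s s 0"
| trans: "\<lbrakk> ccstep R s t c; ccsteps R t u d \<rbrakk> \<Longrightarrow> ccsteps R s u (c + d)"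

definition cond_step :: "('f, 'v) crule set \<Rightarrow> ('f, 'v) ltrm \<Rightarrow> ('f, 'v) ltrm \<Rightarrow> bool" where
  "cond_step R s t = (\<exists>p f Rl \<rho> ls \<sigma> j. p \<in> poss s \<and>
      subt s p = Fun (LD f Rl) (map (\<lambda>l. subst \<sigma> (label R l)) ls) \<and>
      \<rho> \<in> Rl \<and> lhs \<rho> = Fun f ls \<and> j < length (conds \<rho>) \<and>
      (\<forall>i < j. \<exists>c. ccsteps R (subst \<sigma> (label R (fst (conds \<rho> ! i))))
                               (subst \<sigma> (label R (snd (conds \<rho> ! i)))) c) \<and>
      t = subst \<sigma> (label R (fst (conds \<rho> ! j))))"

definition lnonterm :: "('f, 'v) crule set \<Rightarrow> ('f, 'v) ltrm \<Rightarrow> bool" where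
  "lnonterm R s = (\<exists>g. g 0 = s \<and>
      (\<forall>n. (\<exists>c. ccstep R (g n) (g (Suc n)) c) \<or> cond_step R (g n) (g (Suc n))))"

definition dh :: "('f, 'v) crule set \<Rightarrow> ('f, 'v) ltrm \<Rightarrow> enat" where
  "dh R s = Sup ({enat c | c t. ccsteps R s t c} \<union> (if lnonterm R s then {\<infinity>} else {}))"

definition basic :: "('f \<Rightarrow> nat) \<Rightarrow> ('f, 'v) crule set \<Rightarrow> ('f, 'v) trm \<Rightarrow> bool" where
  "basic ar R t = (\<exists>f ts. t = Fun f ts \<and> f \<in> defs R \<and> wf ar t \<and> (\<forall>u\<in>set ts. constr_term R u))"

definition crc :: "('f \<Rightarrow> nat) \<Rightarrow> ('f, 'v) crule set \<Rightarrow> nat \<Rightarrow> enat" where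
  "crc ar R n = Sup {dh R (label R t) | t. ground t \<and> basic ar R t \<and> tsize t \<le> n}"

datatype 'f hsym = HBot | HTop | HF 'f | HC 'f nat nat

datatype 'v xvar = OV 'v | XV nat | YV nat | AV "nat list"

type_synonym ('f, 'v) htrm = "('f hsym, 'v xvar) trm"

fun xi :: "('f, 'v) crule set \<Rightarrow> 'f hsym \<Rightarrow> ('f, 'v) trm \<Rightarrow> ('f, 'v) htrm" where
  "xi R st (Var x) = Var (OV x)"
| "xi R st (Fun f ts) = Fun (HF f) (map (xi R st) ts @ replicate (mR R f) (Fun st []))"

text \<open>\<langle>xs\<rangle>[us]_i (1-based i)\<close>
definition rep :: "'a list \<Rightarrow> nat \<Rightarrow> 'a list \<Rightarrow> 'a list" where
  "rep xs i us = take (i - 1) xs @ us @ drop i xs"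

definition xvars :: "('f, 'v) crule set \<Rightarrow> 'f \<Rightarrow> ('f, 'v) htrm list" where
  "xvars R f = map (\<lambda>k. Var (XV k)) [1..<mR R f + 1]"

definition yvars :: "nat \<Rightarrow> ('f, 'v) htrm list" where
  "yvars n = map (\<lambda>k. Var (YV k)) [1..<n + 1]"

text \<open>isAP R ar p t v: v \<in> AP(t); fresh variables are named by positions (prefix p).\<close>
inductive isAP :: "('f, 'v) crule set \<Rightarrow> ('f \<Rightarrow> nat) \<Rightarrow> nat list \<Rightarrow> ('f, 'v) trm \<Rightarrow> ('f, 'v) htrm \<Rightarrow> bool"
  for R ar where
  ap_con: "\<lbrakk> g \<notin> defs R; g \<noteq> f \<rbrakk> \<Longrightarrow>
     isAP R ar p (Fun f ts) (Fun (HF g) (map (\<lambda>k. Var (AV (p @ [k]))) [1..<ar g + 1]))"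
| ap_def: "g \<in> defs R \<Longrightarrow>
     isAP R ar p (Fun f ts)
       (Fun (HF g) (map (\<lambda>k. Var (AV (p @ [k]))) [1..<ar g + 1] @ replicate (mR R g) (Fun HBot [])))"
| ap_arg: "\<lbrakk> 1 \<le> i; i \<le> length ts; isAP R ar (p @ [i]) (ts ! (i - 1)) u \<rbrakk> \<Longrightarrow>
     isAP R ar p (Fun f ts)
       (Fun (HF f) (map (\<lambda>k. if k = i then u else Var (AV (p @ [k]))) [1..<length ts + 1]))"

text \<open>Rules of \<Xi>(R); the Boolean flag marks rules of type (1) or (3) (the costly ones).\<close>
definition Xi :: "('f \<Rightarrow> nat) \<Rightarrow> ('f, 'v) crule set \<Rightarrow> ('f \<Rightarrow> nat \<Rightarrow> ('f, 'v) crule)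
                   \<Rightarrow> (('f, 'v) htrm \<times> ('f, 'v) htrm \<times> bool) set" where
  "Xi ar R enum = {(l, r, cst) | l r cst. \<exists>f i \<rho> ls.
     f \<in> defs R \<and> 1 \<le> i \<and> i \<le> mR R f \<and> \<rho> = enum f i \<and> lhs \<rho> = Fun f ls \<and>
     (let L = map (xi R HTop) ls; X = xvars R f; cs = conds \<rho>; k = length cs;
          a = (\<lambda>j. xi R HTop (fst (cs ! (j - 1)))); b = (\<lambda>j. xi R HTop (snd (cs ! (j - 1))));
          T = Fun HTop []; B = Fun HBot [] in
       (k = 0 \<and> l = Fun (HF f) (L @ rep X i [T]) \<and> r = xi R HTop (rhs \<rho>) \<and> cst)
     \<or> (k > 0 \<and> l = Fun (HF f) (L @ rep X i [T]) \<and> r = Fun (HC f i 1) (L @ rep X i [a 1]) \<and> \<not> cst)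
     \<or> (k > 0 \<and> l = Fun (HC f i k) (L @ rep X i (map b [1..<k + 1])) \<and> r = xi R HTop (rhs \<rho>) \<and> cst)
     \<or> (\<exists>j. 1 \<le> j \<and> j < k \<and> l = Fun (HC f i j) (L @ rep X i (map b [1..<j + 1])) \<and>
            r = Fun (HC f i (j + 1)) (L @ rep X i (map b [1..<j + 1] @ [a (j + 1)])) \<and> \<not> cst)
     \<or> (\<exists>j v. 1 \<le> j \<and> j \<le> k \<and> isAP R ar [] (snd (cs ! (j - 1))) v \<and>
            l = Fun (HC f i j) (L @ rep X i (map b [1..<j] @ [v])) \<and>
            r = Fun (HF f) (L @ rep X i [B]) \<and> \<not> cst)
     \<or> (\<exists>j v. 1 \<le> j \<and> j \<le> length ls \<and> isAP R ar [] (ls ! (j - 1)) v \<and>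
            l = Fun (HF f) (rep (yvars (length ls)) j [v] @ rep X i [T]) \<and>
            r = Fun (HF f) (rep (yvars (length ls)) j [v] @ rep X i [B]) \<and> \<not> cst))}"

fun harity :: "('f \<Rightarrow> nat) \<Rightarrow> ('f, 'v) crule set \<Rightarrow> 'f hsym \<Rightarrow> nat" where
  "harity ar R HBot = 0"
| "harity ar R HTop = 0"
| "harity ar R (HF f) = ar f + mR R f"
| "harity ar R (HC f i j) = ar f + mR R f + j - 1"

definition valid_HC :: "('f, 'v) crule set \<Rightarrow> ('f \<Rightarrow> nat \<Rightarrow> ('f, 'v) crule) \<Rightarrow> 'f \<Rightarrow> nat \<Rightarrow> nat \<Rightarrow> bool" where
  "valid_HC R enum f i j = (f \<in> defs R \<and> 1 \<le> i \<and> i \<le> mR R f \<and>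
     0 < length (conds (enum f i)) \<and> 1 \<le> j \<and> j \<le> length (conds (enum f i)))"

fun mu :: "('f \<Rightarrow> nat) \<Rightarrow> 'f hsym \<Rightarrow> nat set" where
  "mu ar HBot = {}"
| "mu ar HTop = {}"
| "mu ar (HF f) = {1..ar f}"
| "mu ar (HC f i j) = {ar f + i + j - 1}"

fun muups :: "('f \<Rightarrow> nat) \<Rightarrow> ('f \<Rightarrow> nat set) \<Rightarrow> 'f hsym \<Rightarrow> nat set" where
  "muups ar ups (HF f) = ups f"
| "muups ar ups g = mu ar g"

definition xstep :: "('f \<Rightarrow> nat) \<Rightarrow> ('f, 'v) crule set \<Rightarrow> ('f \<Rightarrow> nat \<Rightarrow> ('f, 'v) crule)
    \<Rightarrow> ('f hsym \<Rightarrow> nat set) \<Rightarrow> ('f, 'v) htrm \<Rightarrow> ('f, 'v) htrm \<Rightarrow> nat \<Rightarrow> bool" where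
  "xstep ar R enum \<nu> s t c = (\<exists>l r cst p \<sigma>. (l, r, cst) \<in> Xi ar R enum \<and>
      p \<in> poss s \<and> active \<nu> s p \<and> subt s p = subst \<sigma> l \<and>
      t = replace_at s p (subst \<sigma> r) \<and> c = (if cst then 1 else 0))"

inductive xsteps :: "('f \<Rightarrow> nat) \<Rightarrow> ('f, 'v) crule set \<Rightarrow> ('f \<Rightarrow> nat \<Rightarrow> ('f, 'v) crule)
    \<Rightarrow> ('f hsym \<Rightarrow> nat set) \<Rightarrow> ('f, 'v) htrm \<Rightarrow> ('f, 'v) htrm \<Rightarrow> nat \<Rightarrow> bool"
  for ar R enum \<nu> where
  xrefl: "xsteps ar R enum \<nu> s s 0"
| xtrans: "\<lbrakk> xstep ar R enum \<nu> s t c; xsteps ar R enum \<nu> t u d \<rbrakk> \<Longrightarrow> xsteps ar R enum \<nu> s u (c + d)"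

definition dhx :: "('f \<Rightarrow> nat) \<Rightarrow> ('f, 'v) crule set \<Rightarrow> ('f \<Rightarrow> nat \<Rightarrow> ('f, 'v) crule)
    \<Rightarrow> ('f hsym \<Rightarrow> nat set) \<Rightarrow> ('f, 'v) htrm \<Rightarrow> enat" where
  "dhx ar R enum \<nu> s = Sup ({enat c | c t. xsteps ar R enum \<nu> s t c} \<union>
      (if \<exists>g. g 0 = s \<and> (\<forall>n. \<exists>c. xstep ar R enum \<nu> (g n) (g (Suc n)) c) then {\<infinity>} else {}))"

definition hbasic :: "('f \<Rightarrow> nat) \<Rightarrow> ('f, 'v) crule set \<Rightarrow> ('f \<Rightarrow> nat \<Rightarrow> ('f, 'v) crule)
    \<Rightarrow> ('f, 'v) htrm \<Rightarrow> bool" where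
  "hbasic ar R enum s = (\<exists>g ts. s = Fun g ts \<and> ground s \<and> wf (harity ar R) s \<and>
      ((\<exists>f. g = HF f \<and> f \<in> defs R) \<or> (\<exists>f i j. g = HC f i j \<and> valid_HC R enum f i j)) \<and>
      (\<forall>u\<in>set ts. \<forall>h\<in>funs u. h = HBot \<or> h = HTop \<or> (\<exists>c. h = HF c \<and> c \<notin> defs R)))"

fun hsize :: "('f, 'v) htrm \<Rightarrow> nat" where
  "hsize (Var x) = 1"
| "hsize (Fun g ts) = (if g = HTop then 0 else 1) + sum_list (map hsize ts)"

definition rc :: "('f \<Rightarrow> nat) \<Rightarrow> ('f, 'v) crule set \<Rightarrow> ('f \<Rightarrow> nat \<Rightarrow> ('f, 'v) crule)
    \<Rightarrow> ('f hsym \<Rightarrow> nat set) \<Rightarrow> nat \<Rightarrow> enat" where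
  "rc ar R enum \<nu> n = Sup {dhx ar R enum \<nu> s | s. hbasic ar R enum s \<and> hsize s \<le> n}"

definition usable :: "('f, 'v) crule set \<Rightarrow> ('f \<Rightarrow> nat set) \<Rightarrow> bool" where
  "usable R ups = (\<forall>\<rho>\<in>R.
     let cs = conds \<rho>; k = length cs;
         A = (\<lambda>i. if i = k + 1 then rhs \<rho> else fst (cs ! (i - 1)));
         Bt = (\<lambda>j. if j = 0 then lhs \<rho> else snd (cs ! (j - 1))) in
     \<forall>i p. 1 \<le> i \<and> i \<le> k + 1 \<and> p \<in> poss (A i) \<and>
        ((\<exists>g ts. subt (A i) p = Fun g ts \<and> g \<in> defs R) \<or>
         (\<exists>x. subt (A i) p = Var x \<and>
              (\<exists>j q. j < i \<and> active ups (Bt j) q \<and> subt (Bt j) q = Var x)))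
        \<longrightarrow> active ups (A i) p)"

end

theory Submission
  imports Defs
begin

text \<open>A labeled term is translated by writing the label \<open>S\<close> of \<open>f\<^sub>S\<close> as flags: the extra argument \<open>i\<close> of
  \<open>f\<close> is \<open>\<top>\<close> if the \<open>i\<close>-th rule is in \<open>S\<close> and \<open>\<bottom>\<close> otherwise. Each labeled step is then simulated, with
  the same cost, by at least one step of the transformed system: the conditions are evaluated one after
  the other in the active argument of the symbols \<open>f\<^sub>i\<^sup>j\<close>, and by linearity a failure of unification
  is a clash of symbols at some position, which an anti-pattern of the failing constructor term detects.
  A step into a condition is simulated by steps to a term with the translated condition at an active
  position, so infinite reductions are preserved as well.\<close>

subsection \<open>Positions and replacement\<close>

lemma subt_at_append:
  "subt_at t (p @ q) = (case subt_at t p of None \<Rightarrow> None | Some s \<Rightarrow> subt_at s q)"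
  by (induction t p rule: subt_at.induct) auto

lemma subt_at_replace_at: "subt_at t p = Some s \<Longrightarrow> subt_at (replace_at t p u) p = Some u"
  by (induction t p rule: subt_at.induct) (auto split: if_splits)

lemma replace_at_append:
  "subt_at t p = Some s \<Longrightarrow> replace_at t (p @ q) u = replace_at t p (replace_at s q u)"
  by (induction t p rule: subt_at.induct) (auto split: if_splits)

lemma replace_at_replace_at:
  "subt_at t p = Some s \<Longrightarrow> replace_at (replace_at t p u) p w = replace_at t p w"
  by (induction t p rule: subt_at.induct) (auto split: if_splits)

lemma replace_at_same: "subt_at t p = Some s \<Longrightarrow> replace_at t p s = t"
  by (induction t p rule: subt_at.induct) (auto split: if_splits)

lemma active_append:
  "subt_at t p = Some s \<Longrightarrow> active \<nu> t (p @ q) \<longleftrightarrow> active \<nu> t p \<and> active \<nu> s q"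
  by (induction t p rule: subt_at.induct) (auto split: if_splits)

lemma active_replace_at:
  "subt_at t p = Some s \<Longrightarrow> active \<nu> t p \<Longrightarrow> active \<nu> (replace_at t p u) p"
  by (induction t p rule: subt_at.induct) (auto split: if_splits)

lemma vars_Fun: "vars (Fun f ts) = (\<Union>t\<in>set ts. vars t)"
  by (auto simp: vars_def)

lemma vars_Var: "vars (Var x) = {x}"
  by (auto simp: vars_def)

lemma subst_cong_vars: "(\<And>x. x \<in> vars t \<Longrightarrow> \<sigma> x = \<tau> x) \<Longrightarrow> subst \<sigma> t = subst \<tau> t"
  by (induction t) (auto simp: vars_Fun vars_Var)

lemma subst_Var: "subst Var t = t"
  by (induction t) (auto intro: map_idI)

lemma var_position: "x \<in> vars t \<Longrightarrow> \<exists>p. subt_at t p = Some (Var x)"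
proof (induction t)
  case (Var y)
  then show ?case by (auto simp: vars_Var intro: exI[of _ "[]"])
next
  case (Fun f ts)
  then obtain i where i: "i < length ts" "x \<in> vars (ts ! i)"
    by (auto simp: vars_Fun in_set_conv_nth)
  with Fun.IH[of "ts ! i"] obtain p where "subt_at (ts ! i) p = Some (Var x)"
    by auto
  with i have "subt_at (Fun f ts) (Suc i # p) = Some (Var x)" by simp
  then show ?case by blast
qed

lemma poss_iff: "p \<in> poss t \<longleftrightarrow> subt_at t p = Some (subt t p)"
  by (auto simp: poss_def subt_def)

lemma rep_single: "1 \<le> i \<Longrightarrow> i \<le> length xs \<Longrightarrow> rep xs i [u] = xs[i - 1 := u]"
  by (simp add: rep_def upd_conv_take_nth_drop)

lemma map_rep: "map g (rep xs i us) = rep (map g xs) i (map g us)"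
  by (simp add: rep_def take_map drop_map)

section \<open>Linear argument lists and unification\<close>

lemma distinct_concat_disjoint:
  assumes "distinct (concat xss)" "i < length xss" "j < length xss"
    "x \<in> set (xss ! i)" "x \<in> set (xss ! j)"
  shows "i = j"
  using assms
proof (induction xss arbitrary: i j)
  case (Cons xs xss)
  have "x \<notin> set xs \<or> x \<notin> set (xss ! n)" if "n < length xss" for n
    using Cons.prems(1) nth_mem[OF that] by auto
  with Cons show ?case
    by (cases i; cases j) auto
qed simp

text \<open>In a linear argument list a variable belongs to at most one argument, so it can take its
  value from the substitution of the argument that contains it; \<open>SOME\<close> picks that
  unique index.\<close>

lemma glue_substs:
  assumes "distinct (concat (map vars_list ts))"
  shows "\<exists>\<sigma>. \<forall>i < length ts. subst \<sigma> (ts ! i) = subst (\<tau> i) (ts ! i)"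
proof -
  define \<sigma> where "\<sigma> x = \<tau> (SOME i. i < length ts \<and> x \<in> vars (ts ! i)) x" for x
  have "\<sigma> x = \<tau> i x" if "i < length ts" "x \<in> vars (ts ! i)" for i x
  proof -
    have "(SOME i. i < length ts \<and> x \<in> vars (ts ! i)) = i"
      using that distinct_concat_disjoint[OF assms]
      by (intro some_equality) (auto simp: vars_def)
    then show ?thesis by (simp add: \<sigma>_def)
  qed
  then show ?thesis by (intro exI[of _ \<sigma>]) (auto intro: subst_cong_vars)
qed

text \<open>Used in contrapositive form: a clash between linear terms with the same root is already
  a clash between two corresponding arguments. The two sides are glued separately, since
  \<open>unifiable\<close> applies independent substitutions to them.\<close>

lemma unifiable_Fun:
  fixes ss ts :: "('f, 'v) trm list"
  assumes "distinct (concat (map vars_list ss))" "distinct (concat (map vars_list ts))"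
    and "length ss = length ts" "\<And>i. i < length ts \<Longrightarrow> unifiable (ss ! i) (ts ! i)"
  shows "unifiable (Fun f ss) (Fun f ts)"
proof -
  from assms(4) have "\<forall>i. \<exists>\<sigma> \<tau> :: 'v \<Rightarrow> ('f, 'v) trm. i < length ts \<longrightarrow> subst \<sigma> (ss ! i) = subst \<tau> (ts ! i)"
    by (auto simp: unifiable_def)
  then obtain \<sigma>' \<tau>' :: "nat \<Rightarrow> 'v \<Rightarrow> ('f, 'v) trm" where *: "\<And>i. i < length ts \<Longrightarrow> subst (\<sigma>' i) (ss ! i) = subst (\<tau>' i) (ts ! i)"
    by metis
  obtain \<sigma> where \<sigma>: "\<forall>i < length ss. subst \<sigma> (ss ! i) = subst (\<sigma>' i) (ss ! i)"
    using glue_substs[OF assms(1)] by blast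
  obtain \<tau> where \<tau>: "\<forall>i < length ts. subst \<tau> (ts ! i) = subst (\<tau>' i) (ts ! i)"
    using glue_substs[OF assms(2)] by blast
  have "subst \<sigma> (Fun f ss) = subst \<tau> (Fun f ts)"
    using * \<sigma> \<tau> assms(3) by (auto intro: nth_equalityI)
  then show ?thesis by (auto simp: unifiable_def)
qed

lemma linear_nth: "distinct (concat (map vars_list ts)) \<Longrightarrow> i < length ts \<Longrightarrow> linear (ts ! i)"
  by (simp add: linear_def distinct_concat_iff)

lemma vars_list_erase: "vars_list (erase t) = vars_list t"
  by (induction t) (auto intro: arg_cong[of _ _ concat])

subsection \<open>Reductions of the transformed system\<close>

text \<open>At least one step is demanded, and not merely the right cost: steps of cost 0 must be
  matched too when infinite reductions are carried over.\<close>

definition xplus where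
  "xplus ar R enum \<nu> s t c =
     (\<exists>s' c1 c2. xstep ar R enum \<nu> s s' c1 \<and> xsteps ar R enum \<nu> s' t c2 \<and> c = c1 + c2)"

lemma xsteps_trans:
  "xsteps ar R enum \<nu> s t c \<Longrightarrow> xsteps ar R enum \<nu> t u d \<Longrightarrow> xsteps ar R enum \<nu> s u (c + d)"
  by (induction rule: xsteps.induct) (auto simp: add.assoc intro: xsteps.xtrans)

lemma xstep_imp_xsteps: "xstep ar R enum \<nu> s t c \<Longrightarrow> xsteps ar R enum \<nu> s t c"
  using xsteps.xtrans[OF _ xsteps.xrefl] by force

lemma xstep_imp_xplus: "xstep ar R enum \<nu> s t c \<Longrightarrow> xplus ar R enum \<nu> s t c"
  unfolding xplus_def using xsteps.xrefl by force

lemma xplus_imp_xsteps: "xplus ar R enum \<nu> s t c \<Longrightarrow> xsteps ar R enum \<nu> s t c"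
  by (auto simp: xplus_def intro: xsteps.xtrans)

lemma xplus_xsteps:
  "xplus ar R enum \<nu> s t c \<Longrightarrow> xsteps ar R enum \<nu> t u d \<Longrightarrow> xplus ar R enum \<nu> s u (c + d)"
  unfolding xplus_def by (metis xsteps_trans add.assoc)

text \<open>Activity composes along positions: a step at the active position \<open>q\<close> of
  \<open>s\<close> becomes a step at \<open>p @ q\<close>, which is active in
  \<open>h\<close>.\<close>

lemma xstep_at:
  assumes "xstep ar R enum \<nu> s s' c" "subt_at h p = Some s" "active \<nu> h p"
  shows "xstep ar R enum \<nu> h (replace_at h p s') c"
proof -
  from assms(1) obtain l r cst q \<sigma> where *: "(l, r, cst) \<in> Xi ar R enum" "q \<in> poss s"
    "active \<nu> s q" "subt s q = subst \<sigma> l" "s' = replace_at s q (subst \<sigma> r)"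
    "c = (if cst then 1 else 0)"
    unfolding xstep_def by blast
  have "p @ q \<in> poss h" "active \<nu> h (p @ q)" "subt h (p @ q) = subst \<sigma> l"
    "replace_at h p s' = replace_at h (p @ q) (subst \<sigma> r)"
    using * assms(2,3)
    by (auto simp: poss_def subt_def subt_at_append active_append replace_at_append)
  then show ?thesis
    unfolding xstep_def using *(1,6) by blast
qed

lemma xsteps_at:
  assumes "xsteps ar R enum \<nu> s t c" "subt_at h p = Some s" "active \<nu> h p"
  shows "xsteps ar R enum \<nu> h (replace_at h p t) c"
  using assms
proof (induction arbitrary: h rule: xsteps.induct)
  case (xrefl s)
  then show ?case by (simp add: replace_at_same xsteps.xrefl)
next
  case (xtrans s t c u d)
  have "xsteps ar R enum \<nu> (replace_at h p t) (replace_at (replace_at h p t) p u) d"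
    using xtrans by (intro xtrans.IH) (auto simp: subt_at_replace_at active_replace_at)
  then show ?case
    using xstep_at[OF xtrans.hyps(1) xtrans.prems] xtrans.prems
    by (auto simp: replace_at_replace_at intro: xsteps.xtrans)
qed

lemma xplus_at:
  assumes "xplus ar R enum \<nu> s t c" "subt_at h p = Some s" "active \<nu> h p"
  shows "xplus ar R enum \<nu> h (replace_at h p t) c"
proof -
  from assms(1) obtain s' c1 c2 where *: "xstep ar R enum \<nu> s s' c1"
    "xsteps ar R enum \<nu> s' t c2" "c = c1 + c2"
    by (auto simp: xplus_def)
  have "xsteps ar R enum \<nu> (replace_at h p s') (replace_at (replace_at h p s') p t) c2"
    using * assms by (intro xsteps_at) (auto simp: subt_at_replace_at active_replace_at)
  then show ?thesis
    using xstep_at[OF *(1) assms(2,3)] * assms(2)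
    by (auto simp: xplus_def replace_at_replace_at)
qed

lemma xsteps_arg:
  assumes "xsteps ar R enum \<nu> s t c" "Suc (length xs) \<in> \<nu> g"
  shows "xsteps ar R enum \<nu> (Fun g (xs @ s # ys)) (Fun g (xs @ t # ys)) c"
  using xsteps_at[OF assms(1), of "Fun g (xs @ s # ys)" "[Suc (length xs)]"] assms(2)
  by simp

lemma xplus_imp_tranclp:
  "xplus ar R enum \<nu> s t c \<Longrightarrow> (\<lambda>s t. \<exists>c. xstep ar R enum \<nu> s t c)\<^sup>+\<^sup>+ s t"
proof -
  have "(\<lambda>s t. \<exists>c. xstep ar R enum \<nu> s t c)\<^sup>*\<^sup>* s t" if "xsteps ar R enum \<nu> s t c" for s t c
    using that by (induction rule: xsteps.induct) (auto intro: converse_rtranclp_into_rtranclp)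
  then show "xplus ar R enum \<nu> s t c \<Longrightarrow> (\<lambda>s t. \<exists>c. xstep ar R enum \<nu> s t c)\<^sup>+\<^sup>+ s t"
    unfolding xplus_def by (metis (mono_tags, lifting) rtranclp_into_tranclp2)
qed

text \<open>Every element from which some \<open>h n\<close> is reachable has an
  \<open>r\<close>-successor of the same kind, because one can go on from \<open>h n\<close> to
  \<open>h (Suc n)\<close> in at least one step. Dependent choice then yields the chain.\<close>

lemma infinite_chain_tranclp:
  assumes "\<And>n. r\<^sup>+\<^sup>+ (h n) (h (Suc n))"
  shows "\<exists>g. g 0 = h 0 \<and> (\<forall>n. r (g n) (g (Suc n)))"
proof -
  define S where "S = {x. \<exists>n. r\<^sup>*\<^sup>* x (h n)}"
  have "\<exists>y\<in>S. r x y" if "x \<in> S" for x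
  proof -
    from that obtain n where n: "r\<^sup>*\<^sup>* x (h n)" by (auto simp: S_def)
    then have "r\<^sup>+\<^sup>+ x (h (Suc n))" using assms[of n] by (rule rtranclp_tranclp_tranclp)
    then show ?thesis by (auto simp: S_def dest: tranclpD)
  qed
  moreover have "h 0 \<in> S" by (auto simp: S_def)
  \<comment> \<open>The conjunct for \<open>n = 0\<close> in the choice predicate forces the chain
    to start at \<open>h 0\<close>.\<close>
  ultimately have "\<exists>g. (g 0 = h 0 \<and> (\<forall>n. g n \<in> S)) \<and> (\<forall>n. r (g n) (g (Suc n)))"
    using dependent_nat_choice[of "\<lambda>n x. x \<in> S \<and> (n = 0 \<longrightarrow> x = h 0)" "\<lambda>_ x y. r x y"]
    by blast
  then show ?thesis by blast
qed

subsection \<open>The simulation\<close>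

definition cfree :: "('f, 'v) ltrm \<Rightarrow> bool" where
  "cfree t \<longleftrightarrow> (\<forall>g\<in>funs t. \<exists>c. g = LC c)"

text \<open>The datatype \<open>lsym\<close> also admits \<open>LC\<close> on defined symbols and
  arbitrary rule sets as labels; this carves out the intended labeled signature.\<close>

fun lsym_ok :: "('f, 'v) crule set \<Rightarrow> ('f, 'v) lsym \<Rightarrow> bool" where
  "lsym_ok R (LC c) \<longleftrightarrow> c \<notin> defs R"
| "lsym_ok R (LD f S) \<longleftrightarrow> f \<in> defs R \<and> S \<subseteq> restr R f"

lemma cfree_simps [simp]:
  "cfree (Var x)"
  "cfree (Fun g ts) \<longleftrightarrow> (\<exists>c. g = LC c) \<and> (\<forall>t\<in>set ts. cfree t)"
  by (auto simp: cfree_def)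

locale simulation =
  fixes ar :: "'f \<Rightarrow> nat"
    and R :: "('f, 'v) crule set"
    and enum :: "'f \<Rightarrow> nat \<Rightarrow> ('f, 'v) crule"
    and ups :: "'f \<Rightarrow> nat set"
  assumes strong: "strong_cctrs ar R"
    and enum: "\<And>f. bij_betw (enum f) {1..mR R f} (restr R f)"
    and usable: "usable R ups"
begin

abbreviation "\<nu> \<equiv> muups ar ups"
abbreviation "hstep \<equiv> xstep ar R enum \<nu>"
abbreviation "hsteps \<equiv> xsteps ar R enum \<nu>"
abbreviation "hplus \<equiv> xplus ar R enum \<nu>"

text \<open>The invariant of reductions from basic terms: below an inactive argument there are no
  defined symbols, whatever their label. Hence labeled steps only happen at active positions.\<close>
fun good :: "('f, 'v) ltrm \<Rightarrow> bool" where
  "good (Var x) \<longleftrightarrow> True"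
| "good (Fun g ts) \<longleftrightarrow> lsym_ok R g \<and> length ts = ar (esym g) \<and> (\<forall>t\<in>set ts. good t) \<and>
     (\<forall>i < length ts. Suc i \<notin> ups (esym g) \<longrightarrow> cfree (ts ! i))"

section \<open>Translation of labels into flags\<close>

definition flags :: "'f \<Rightarrow> ('f, 'v) crule set \<Rightarrow> ('f, 'v) htrm list" where
  "flags f S = map (\<lambda>i. Fun (if enum f i \<in> S then HTop else HBot) []) [1..<mR R f + 1]"

text \<open>\<open>LC f\<close> receives no flags. For a constructor \<open>f\<close> this agrees
  with \<open>xi\<close>, because \<open>mR R f\<close> is then 0.\<close>

fun zeta :: "('f, 'v) ltrm \<Rightarrow> ('f, 'v) htrm" where
  "zeta (Var x) = Var (OV x)"
| "zeta (Fun (LC f) ts) = Fun (HF f) (map zeta ts)"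
| "zeta (Fun (LD f S) ts) = Fun (HF f) (map zeta ts @ flags f S)"

lemma length_flags [simp]: "length (flags f S) = mR R f"
  by (simp add: flags_def)

lemma mR_constr: "f \<notin> defs R \<Longrightarrow> mR R f = 0"
proof -
  assume "f \<notin> defs R"
  then have "restr R f = {}" by (auto simp: defs_def restr_def)
  then show ?thesis by (simp add: mR_def)
qed

lemma enum_in: "1 \<le> i \<Longrightarrow> i \<le> mR R f \<Longrightarrow> enum f i \<in> restr R f"
  using enum[of f] by (auto simp: bij_betw_def)

lemma flags_restr: "flags f (restr R f) = replicate (mR R f) (Fun HTop [])"
  by (rule nth_equalityI) (auto simp: flags_def enum_in simp del: upt_Suc)

lemma flags_empty: "flags f {} = replicate (mR R f) (Fun HBot [])"
  by (rule nth_equalityI) (auto simp: flags_def simp del: upt_Suc)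

text \<open>Read from right to left, this brings a translated term into the shape of a left-hand
  side that asks for \<open>HTop\<close> at flag \<open>i\<close>.\<close>

lemma rep_flags_top:
  assumes "enum f i \<in> S" "1 \<le> i" "i \<le> mR R f"
  shows "rep (flags f S) i [Fun HTop []] = flags f S"
proof -
  have "flags f S ! (i - 1) = Fun HTop []"
    using assms by (simp add: flags_def del: upt_Suc)
  then show ?thesis using assms by (simp add: rep_single) (metis list_update_id)
qed

text \<open>Injectivity of \<open>enum f\<close> ensures that removing one rule from the label
  affects no other flag.\<close>

lemma rep_flags_bot:
  assumes "1 \<le> i" "i \<le> mR R f"
  shows "rep (flags f S) i [Fun HBot []] = flags f (S - {enum f i})"
proof -
  have inj: "enum f a = enum f i \<longleftrightarrow> a = i" if "1 \<le> a" "a \<le> mR R f" for a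
    using inj_on_eq_iff[of "enum f" "{1..mR R f}" a i] enum[of f] that assms
    by (simp add: bij_betw_def)
  have "(flags f S)[i - 1 := Fun HBot []] = flags f (S - {enum f i})"
    using assms by (intro nth_equalityI) (auto simp: flags_def nth_list_update inj simp del: upt_Suc)
  then show ?thesis using assms by (simp add: rep_single)
qed

text \<open>\<open>label\<close> puts the full rule set on every defined symbol, and the flags of
  that set are all \<open>HTop\<close>, which is what \<open>xi R HTop\<close> appends.\<close>

lemma zeta_label:
  "(\<And>x. \<theta> (OV x) = zeta (\<sigma> x)) \<Longrightarrow> subst \<theta> (xi R HTop t) = zeta (subst \<sigma> (label R t))"
  by (induction t) (auto simp: flags_restr mR_constr)

lemma obtain_enum:
  assumes "\<rho> \<in> restr R f"
  obtains i where "1 \<le> i" "i \<le> mR R f" "\<rho> = enum f i"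
proof -
  from assms enum[of f] have "\<rho> \<in> enum f ` {1..mR R f}" by (simp add: bij_betw_def)
  then show ?thesis using that by auto
qed

section \<open>The invariant and active positions\<close>

lemma good_subt: "good s \<Longrightarrow> subt_at s p = Some t \<Longrightarrow> good t"
  by (induction s p rule: subt_at.induct) (auto split: if_splits)

lemma cfree_subt: "cfree s \<Longrightarrow> subt_at s p = Some t \<Longrightarrow> cfree t"
  by (induction s p rule: subt_at.induct) (auto split: if_splits)

text \<open>If some argument index on the path \<open>p\<close> were inactive, the argument there
  would be \<open>cfree\<close>, and so would \<open>t\<close>. Positions carry over unchanged
  because the flags stand behind the ordinary arguments.\<close>

lemma zeta_position:
  assumes "good s" "subt_at s p = Some t" "\<not> cfree t"
  shows "subt_at (zeta s) p = Some (zeta t)" "active \<nu> (zeta s) p"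
    "zeta (replace_at s p u) = replace_at (zeta s) p (zeta u)"
    "good u \<Longrightarrow> good (replace_at s p u)"
proof -
  have "subt_at (zeta s) p = Some (zeta t) \<and> active \<nu> (zeta s) p \<and>
    zeta (replace_at s p u) = replace_at (zeta s) p (zeta u) \<and>
    (good u \<longrightarrow> good (replace_at s p u))"
    using assms
  proof (induction s p rule: subt_at.induct)
    case (3 g ts i p)
    then have i: "1 \<le> i" "i \<le> length ts" and sub: "subt_at (ts ! (i - 1)) p = Some t"
      by (auto split: if_splits)
    then have "i - 1 < length ts" by simp
    with 3 sub have act: "i \<in> ups (esym g)"
      using cfree_subt[OF _ sub] i by auto
    have gd: "good (ts ! (i - 1))" using 3 \<open>i - 1 < length ts\<close> by auto
    note IH = 3(1)[OF conjI[OF i] gd sub \<open>\<not> cfree t\<close>]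
    have good: "good (Fun g (ts[i - 1 := v]))" if "good v" for v
      using 3(2) that act i by (auto simp: nth_list_update dest: set_update_subset_insert[THEN subsetD])
    show ?case
      using IH i sub act good \<open>i - 1 < length ts\<close>
      by (cases g) (auto simp: nth_append map_update list_update_append)
  qed auto
  then show "subt_at (zeta s) p = Some (zeta t)" "active \<nu> (zeta s) p"
    "zeta (replace_at s p u) = replace_at (zeta s) p (zeta u)"
    "good u \<Longrightarrow> good (replace_at s p u)"
    by blast+
qed

text \<open>The two activity hypotheses are what usability provides for the terms of a rule:
  whatever can bring a defined symbol into the instance sits at an active position.\<close>

lemma good_subst_label:
  assumes "wf ar t" "\<And>x. x \<in> vars t \<Longrightarrow> good (\<sigma> x)"
    and "\<And>p g ts. subt_at t p = Some (Fun g ts) \<Longrightarrow> g \<in> defs R \<Longrightarrow> active ups t p"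
    and "\<And>p x. subt_at t p = Some (Var x) \<Longrightarrow> \<not> cfree (\<sigma> x) \<Longrightarrow> active ups t p"
  shows "good (subst \<sigma> (label R t))"
  using assms
proof (induction t)
  case (Var x)
  then show ?case by (auto simp: vars_Var)
next
  case (Fun f ts)
  have 1: "good (subst \<sigma> (label R (ts ! i)))" if i: "i < length ts" for i
  proof (rule Fun.IH)
    show "ts ! i \<in> set ts" "wf ar (ts ! i)" using i Fun.prems(1) by auto
    show "good (\<sigma> x)" if "x \<in> vars (ts ! i)" for x
      using that i by (intro Fun.prems(2)) (auto simp: vars_Fun)
    show "active ups (ts ! i) p" if "subt_at (ts ! i) p = Some (Fun g us)" "g \<in> defs R" for p g us
      using that i Fun.prems(3)[of "Suc i # p" g us] by simp
    show "active ups (ts ! i) p" if "subt_at (ts ! i) p = Some (Var x)" "\<not> cfree (\<sigma> x)" for p x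
      using that i Fun.prems(4)[of "Suc i # p" x] by simp
  qed
  have free: "cfree (subst \<sigma> (label R t))"
    if "\<And>p g us. subt_at t p = Some (Fun g us) \<Longrightarrow> g \<notin> defs R"
      "\<And>p x. subt_at t p = Some (Var x) \<Longrightarrow> cfree (\<sigma> x)" for t
    using that
  proof (induction t)
    case (Var x)
    then show ?case using Var.prems(2)[of "[]"] by simp
  next
    case (Fun f ts)
    have "cfree (subst \<sigma> (label R u))" if "u \<in> set ts" for u
    proof -
      from that obtain i where i: "i < length ts" "u = ts ! i" by (auto simp: in_set_conv_nth)
      show ?thesis
      proof (rule Fun.IH[OF that])
        show "g \<notin> defs R" if "subt_at u p = Some (Fun g us)" for p g us
          using that i Fun.prems(1)[of "Suc i # p" g us] by simp
        show "cfree (\<sigma> x)" if "subt_at u p = Some (Var x)" for p x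
          using that i Fun.prems(2)[of "Suc i # p" x] by simp
      qed
    qed
    moreover have "f \<notin> defs R" using Fun.prems(1)[of "[]" f ts] by simp
    ultimately show ?case by auto
  qed
  \<comment> \<open>No position below an inactive index is active, so the activity hypotheses
    exclude defined symbols there, and also variables whose values are not
    \<open>cfree\<close>.\<close>
  have 2: "cfree (subst \<sigma> (label R (ts ! i)))" if i: "i < length ts" "Suc i \<notin> ups f" for i
  proof (rule free)
    show "g \<notin> defs R" if "subt_at (ts ! i) p = Some (Fun g us)" for p g us
      using that i Fun.prems(3)[of "Suc i # p" g us] by auto
    show "cfree (\<sigma> x)" if "subt_at (ts ! i) p = Some (Var x)" for p x
      using that i Fun.prems(4)[of "Suc i # p" x] by auto
  qed
  show ?case
    using 1 2 Fun.prems(1) by (auto simp: in_set_conv_nth)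
qed

text \<open>The converse direction for variables: it extracts what is known about their values from
  a good instance of a left-hand side or of an evaluated condition.\<close>

lemma good_subst_label_var:
  assumes "good (subst \<sigma> (label R t))" "subt_at t p = Some (Var x)"
  shows "good (\<sigma> x) \<and> (cfree (\<sigma> x) \<or> active ups t p)"
proof -
  have cf: "cfree (\<sigma> x)" if "cfree (subst \<sigma> (label R t))" "subt_at t p = Some (Var x)" for t p
    using that by (induction t p rule: subt_at.induct) (auto split: if_splits)
  show ?thesis
    using assms
  proof (induction t p rule: subt_at.induct)
    case (3 g ts i p)
    then have i: "1 \<le> i" "i \<le> length ts" "i - 1 < length ts"
      and sub: "subt_at (ts ! (i - 1)) p = Some (Var x)"
      by (auto split: if_splits)
    have "good (subst \<sigma> (label R (ts ! (i - 1))))" using 3(2) i by auto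
    moreover have "cfree (\<sigma> x) \<or> i \<in> ups g"
    proof (rule disjCI)
      assume "i \<notin> ups g"
      then have "cfree (subst \<sigma> (label R (ts ! (i - 1))))"
        using 3(2) i by (auto split: if_splits)
      then show "cfree (\<sigma> x)" using cf sub by blast
    qed
    ultimately show ?case using 3(1)[OF conjI[OF i(1,2)]] i sub by auto
  qed auto
qed

section \<open>Steps at the root for each kind of rule, and evaluation of conditions\<close>

lemma hstep_rootI:
  assumes "(l, r, cst) \<in> Xi ar R enum" "subst \<theta> l = s" "subst \<theta> r = t" "c = (if cst then 1 else 0)"
  shows "hstep s t c"
  unfolding xstep_def
  by (rule exI[of _ l], rule exI[of _ r], rule exI[of _ cst], rule exI[of _ "[]"], rule exI[of _ \<theta>])
    (use assms in \<open>simp add: poss_def subt_def\<close>)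

text \<open>One substitution serves all rules: \<open>OV\<close> are the rule variables,
  \<open>XV\<close> the flags, \<open>YV\<close> the arguments of \<open>f\<close> in the rules that
  detect a mismatching argument. Anti-pattern variables are named by positions, so
  \<open>AV p\<close> reads the subterm of \<open>w\<close> at \<open>p\<close>.\<close>

fun inst :: "('v \<Rightarrow> ('f, 'v) ltrm) \<Rightarrow> ('f, 'v) htrm list \<Rightarrow> ('f, 'v) htrm list \<Rightarrow> ('f, 'v) htrm
    \<Rightarrow> 'v xvar \<Rightarrow> ('f, 'v) htrm" where
  "inst \<sigma> F Y w (OV x) = zeta (\<sigma> x)"
| "inst \<sigma> F Y w (XV k) = F ! (k - 1)"
| "inst \<sigma> F Y w (YV k) = Y ! (k - 1)"
| "inst \<sigma> F Y w (AV p) = subt w p"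

abbreviation "ev \<sigma> t \<equiv> zeta (subst \<sigma> (label R t))"

lemma inst_xi [simp]: "subst (inst \<sigma> F Y w) (xi R HTop t) = ev \<sigma> t"
  by (rule zeta_label) simp

lemma inst_xvars: "length F = mR R f \<Longrightarrow> map (subst (inst \<sigma> F Y w)) (xvars R f) = F"
  by (rule nth_equalityI) (auto simp: xvars_def simp del: upt_Suc)

lemma inst_yvars: "length Y = n \<Longrightarrow> map (subst (inst \<sigma> F Y w)) (yvars n) = Y"
  by (rule nth_equalityI) (auto simp: yvars_def simp del: upt_Suc)

lemma map_upt_shift: "map g [Suc 0..<Suc j] = map (\<lambda>i. g (Suc i)) [0..<j]"
  by (rule nth_equalityI) (auto simp del: upt_Suc)

context
  fixes f i ls and F :: "('f, 'v) htrm list" and \<sigma> :: "'v \<Rightarrow> ('f, 'v) ltrm"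
  assumes i: "1 \<le> i" "i \<le> mR R f" and lhs: "lhs (enum f i) = Fun f ls" and F: "length F = mR R f"
begin

abbreviation "cs \<equiv> conds (enum f i)"
abbreviation "L \<equiv> map (ev \<sigma>) ls"
abbreviation "BB j \<equiv> map (\<lambda>m. ev \<sigma> (snd (cs ! m))) [0..<j]"

lemma lhs_root_defined: "f \<in> defs R"
  using enum_in[OF i] lhs by (force simp: defs_def restr_def)

lemma start_unconditional:
  assumes "cs = []"
  shows "hstep (Fun (HF f) (L @ rep F i [Fun HTop []])) (ev \<sigma> (rhs (enum f i))) 1"
\<comment> \<open>No \<open>YV\<close> or \<open>AV\<close> variable occurs in this rule, so the
  last two arguments of \<open>inst\<close> are arbitrary; the same holds in the next three
  lemmas.\<close>
proof (rule hstep_rootI[where \<theta> = "inst \<sigma> F [] (Fun HTop [])"])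
  show "(Fun (HF f) (map (xi R HTop) ls @ rep (xvars R f) i [Fun HTop []]),
    xi R HTop (rhs (enum f i)), True) \<in> Xi ar R enum"
    unfolding Xi_def Let_def
    by (rule CollectI, intro exI conjI, rule HOL.refl, rule lhs_root_defined, rule i(1), rule i(2), rule HOL.refl, rule lhs)
      (use assms in \<open>simp\<close>)
qed (auto simp: map_rep inst_xvars[OF F])

lemma start_conditional:
  assumes "cs \<noteq> []"
  shows "hstep (Fun (HF f) (L @ rep F i [Fun HTop []]))
    (Fun (HC f i 1) (L @ rep F i [ev \<sigma> (fst (cs ! 0))])) 0"
proof (rule hstep_rootI[where \<theta> = "inst \<sigma> F [] (Fun HTop [])"])
  show "(Fun (HF f) (map (xi R HTop) ls @ rep (xvars R f) i [Fun HTop []]),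
    Fun (HC f i 1) (map (xi R HTop) ls @ rep (xvars R f) i [xi R HTop (fst (cs ! 0))]), False)
    \<in> Xi ar R enum"
    unfolding Xi_def Let_def
    by (rule CollectI, intro exI conjI, rule HOL.refl, rule lhs_root_defined, rule i(1), rule i(2), rule HOL.refl, rule lhs)
      (use assms in \<open>simp\<close>)
qed (auto simp: map_rep inst_xvars[OF F])

lemma finish_conditional:
  assumes "cs \<noteq> []"
  shows "hstep (Fun (HC f i (length cs)) (L @ rep F i (BB (length cs)))) (ev \<sigma> (rhs (enum f i))) 1"
proof (rule hstep_rootI[where \<theta> = "inst \<sigma> F [] (Fun HTop [])"])
  show "(Fun (HC f i (length cs)) (map (xi R HTop) ls @
      rep (xvars R f) i (map (\<lambda>j. xi R HTop (snd (cs ! (j - 1)))) [1..<length cs + 1])),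
    xi R HTop (rhs (enum f i)), True) \<in> Xi ar R enum"
    unfolding Xi_def Let_def
    by (rule CollectI, intro exI conjI, rule HOL.refl, rule lhs_root_defined, rule i(1), rule i(2), rule HOL.refl, rule lhs)
      (use assms in \<open>simp\<close>)
qed (auto simp: map_rep inst_xvars[OF F] map_upt_shift comp_def simp del: upt_Suc)

lemma next_condition:
  assumes "1 \<le> j" "j < length cs"
  shows "hstep (Fun (HC f i j) (L @ rep F i (BB j)))
    (Fun (HC f i (Suc j)) (L @ rep F i (BB j @ [ev \<sigma> (fst (cs ! j))]))) 0"
proof (rule hstep_rootI[where \<theta> = "inst \<sigma> F [] (Fun HTop [])"])
  show "(Fun (HC f i j) (map (xi R HTop) ls @
      rep (xvars R f) i (map (\<lambda>j. xi R HTop (snd (cs ! (j - 1)))) [1..<j + 1])),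
    Fun (HC f i (j + 1)) (map (xi R HTop) ls @
      rep (xvars R f) i (map (\<lambda>j. xi R HTop (snd (cs ! (j - 1)))) [1..<j + 1] @
        [xi R HTop (fst (cs ! (j + 1 - 1)))])), False) \<in> Xi ar R enum"
    unfolding Xi_def Let_def
    by (rule CollectI, intro exI conjI, rule HOL.refl, rule lhs_root_defined, rule i(1), rule i(2), rule HOL.refl, rule lhs)
      (rule disjI2, rule disjI2, rule disjI2, rule disjI1, intro exI[of _ j], use assms in simp)
qed (auto simp: map_rep inst_xvars[OF F] map_upt_shift comp_def simp del: upt_Suc)

text \<open>The third assumption says that \<open>v\<close> matches \<open>w\<close> when its
  variables read their values off \<open>w\<close>; such a \<open>v\<close> is supplied by
  \<open>mismatch_AP\<close>.\<close>

lemma failed_condition: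
  assumes "j < length cs" "isAP R ar [] (snd (cs ! j)) v" "subst (inst \<sigma> F [] w) v = w"
  shows "hstep (Fun (HC f i (Suc j)) (L @ rep F i (BB j @ [w])))
    (Fun (HF f) (L @ rep F i [Fun HBot []])) 0"
proof (rule hstep_rootI[where \<theta> = "inst \<sigma> F [] w"])
  show "(Fun (HC f i (Suc j)) (map (xi R HTop) ls @
      rep (xvars R f) i (map (\<lambda>j. xi R HTop (snd (cs ! (j - 1)))) [1..<Suc j] @ [v])),
    Fun (HF f) (map (xi R HTop) ls @ rep (xvars R f) i [Fun HBot []]), False) \<in> Xi ar R enum"
    unfolding Xi_def Let_def
    by (rule CollectI, intro exI conjI, rule HOL.refl, rule lhs_root_defined, rule i(1), rule i(2), rule HOL.refl, rule lhs)
      (rule disjI2, rule disjI2, rule disjI2, rule disjI2, rule disjI1, intro exI[of _ "Suc j"] exI[of _ v], use assms in simp)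
qed (use assms(3) in \<open>auto simp: map_rep inst_xvars[OF F] map_upt_shift comp_def simp del: upt_Suc\<close>)

lemma bottom_step:
  assumes "j < length ls" "isAP R ar [] (ls ! j) v" "length ys = length ls"
    "subst (inst \<sigma> F ys (ys ! j)) v = ys ! j"
  shows "hstep (Fun (HF f) (ys @ rep F i [Fun HTop []])) (Fun (HF f) (ys @ rep F i [Fun HBot []])) 0"
proof (rule hstep_rootI[where \<theta> = "inst \<sigma> F ys (ys ! j)"])
  show "(Fun (HF f) (rep (yvars (length ls)) (Suc j) [v] @ rep (xvars R f) i [Fun HTop []]),
    Fun (HF f) (rep (yvars (length ls)) (Suc j) [v] @ rep (xvars R f) i [Fun HBot []]), False)
    \<in> Xi ar R enum"
    unfolding Xi_def Let_def
    by (rule CollectI, intro exI conjI, rule HOL.refl, rule lhs_root_defined, rule i(1), rule i(2), rule HOL.refl, rule lhs)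
      (rule disjI2, rule disjI2, rule disjI2, rule disjI2, rule disjI2, intro exI[of _ "Suc j"] exI[of _ v], use assms in simp)
  \<comment> \<open>Only the argument with list index \<open>j\<close> is matched by
    \<open>v\<close>, the others by variables. Putting \<open>ys ! j\<close> back at its own place
    restores \<open>ys\<close>.\<close>
  have "rep ys (Suc j) [ys ! j] = ys" using assms by (simp add: rep_single)
  then show "subst (inst \<sigma> F ys (ys ! j))
    (Fun (HF f) (rep (yvars (length ls)) (Suc j) [v] @ rep (xvars R f) i [Fun HTop []])) =
    Fun (HF f) (ys @ rep F i [Fun HTop []])"
    "subst (inst \<sigma> F ys (ys ! j))
    (Fun (HF f) (rep (yvars (length ls)) (Suc j) [v] @ rep (xvars R f) i [Fun HBot []])) =
    Fun (HF f) (ys @ rep F i [Fun HBot []])"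
    using assms(3,4) by (simp_all add: map_rep inst_xvars[OF F] inst_yvars)
qed simp

lemma condition_reduction:
  assumes "length ls = ar f" "hsteps s t c"
  shows "hsteps (Fun (HC f i (Suc j)) (L @ rep F i (BB j @ [s])))
    (Fun (HC f i (Suc j)) (L @ rep F i (BB j @ [t]))) c"
proof -
  let ?xs = "L @ take (i - 1) F @ BB j"
  \<comment> \<open>The length is \<open>ar f + (i - 1) + j\<close>, so its successor is
    \<open>ar f + i + j\<close>, the only active index of \<open>HC f i (Suc j)\<close>.\<close>
  have "Suc (length ?xs) \<in> \<nu> (HC f i (Suc j))"
    using i F assms(1) by auto
  from xsteps_arg[OF assms(2) this, of "drop i F"] show ?thesis
    by (simp add: rep_def)
qed

text \<open>\<open>HC f i (Suc j)\<close> stores the right-hand sides of the conditions with list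
  index below \<open>j\<close> and evaluates the one with index \<open>j\<close>. All connecting
  steps are free, so only the conditions contribute cost; the initial step makes the reduction
  nonempty even for \<open>j = 0\<close>.\<close>

lemma evaluate_conditions:
  assumes "length ls = ar f" "j < length cs"
    and "\<And>m. m < j \<Longrightarrow> hsteps (ev \<sigma> (fst (cs ! m))) (ev \<sigma> (snd (cs ! m))) (c m)"
  shows "hplus (Fun (HF f) (L @ rep F i [Fun HTop []]))
    (Fun (HC f i (Suc j)) (L @ rep F i (BB j @ [ev \<sigma> (fst (cs ! j))]))) (sum_list (map c [0..<j]))"
  using assms(2,3)
proof (induction j)
  case 0
  then show ?case using start_conditional by (auto intro: xstep_imp_xplus)
next
  case (Suc j)
  then have 1: "hplus (Fun (HF f) (L @ rep F i [Fun HTop []]))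
    (Fun (HC f i (Suc j)) (L @ rep F i (BB j @ [ev \<sigma> (fst (cs ! j))]))) (sum_list (map c [0..<j]))"
    by simp
  have 2: "hsteps (Fun (HC f i (Suc j)) (L @ rep F i (BB j @ [ev \<sigma> (fst (cs ! j))])))
    (Fun (HC f i (Suc j)) (L @ rep F i (BB (Suc j)))) (c j)"
    using condition_reduction[OF assms(1) Suc.prems(2)[of j]] by simp
  have 3: "hsteps (Fun (HC f i (Suc j)) (L @ rep F i (BB (Suc j))))
    (Fun (HC f i (Suc (Suc j))) (L @ rep F i (BB (Suc j) @ [ev \<sigma> (fst (cs ! Suc j))]))) 0"
    using next_condition[of "Suc j"] Suc.prems(1) by (intro xstep_imp_xsteps) simp
  from xplus_xsteps[OF xplus_xsteps[OF 1 2] 3] show ?case by simp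
qed

end

section \<open>Rule properties, clashes, and the invariant along conditions\<close>

lemma good_mono: "good (Fun (LD f S) ss) \<Longrightarrow> S' \<subseteq> S \<Longrightarrow> good (Fun (LD f S') ss)"
  by auto

lemma rule_props:
  assumes "\<rho> \<in> R" "lhs \<rho> = Fun f ls"
  shows "wf ar (lhs \<rho>)" "wf ar (rhs \<rho>)" "linear (lhs \<rho>)" "\<And>l. l \<in> set ls \<Longrightarrow> constr_term R l"
    "\<And>j. j < length (conds \<rho>) \<Longrightarrow> wf ar (fst (conds \<rho> ! j))"
    "\<And>j. j < length (conds \<rho>) \<Longrightarrow> wf ar (snd (conds \<rho> ! j))"
    "\<And>j. j < length (conds \<rho>) \<Longrightarrow> constr_term R (snd (conds \<rho> ! j))"
    "\<And>j. j < length (conds \<rho>) \<Longrightarrow> linear (snd (conds \<rho> ! j))"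
    "vars (rhs \<rho>) \<subseteq> vars (lhs \<rho>) \<union> (\<Union>j<length (conds \<rho>). vars (snd (conds \<rho> ! j)))"
    "\<And>i. i < length (conds \<rho>) \<Longrightarrow>
      vars (fst (conds \<rho> ! i)) \<subseteq> vars (lhs \<rho>) \<union> (\<Union>j<i. vars (snd (conds \<rho> ! j)))"
proof -
  have c: "cctrs ar R" using strong by (simp add: strong_cctrs_def)
  from bspec[OF c[unfolded cctrs_def] assms(1)] assms(2) have
    1: "wf ar (lhs \<rho>)" "wf ar (rhs \<rho>)" "\<forall>(a, b)\<in>set (conds \<rho>). wf ar a \<and> wf ar b"
    "\<forall>l\<in>set ls. constr_term R l" "\<forall>(a, b)\<in>set (conds \<rho>). constr_term R b"
    "vars (rhs \<rho>) \<subseteq> vars (lhs \<rho>) \<union> (\<Union>(a, b)\<in>set (conds \<rho>). vars b)"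
    "\<forall>i < length (conds \<rho>). vars (fst (conds \<rho> ! i)) \<subseteq>
          vars (lhs \<rho>) \<union> (\<Union>j\<in>{j. j < i}. vars (snd (conds \<rho> ! j)))"
    by auto
  have 2: "linear (lhs \<rho>)" "\<forall>(a, b)\<in>set (conds \<rho>). linear b"
    using strong assms(1) by (auto simp: strong_cctrs_def)
  show "wf ar (lhs \<rho>)" "wf ar (rhs \<rho>)" "linear (lhs \<rho>)" by fact+
  show "constr_term R l" if "l \<in> set ls" for l using 1 that by blast
  have nth: "(fst (conds \<rho> ! j), snd (conds \<rho> ! j)) \<in> set (conds \<rho>)" if "j < length (conds \<rho>)" for j
    using that by simp
  show "wf ar (fst (conds \<rho> ! j))" "wf ar (snd (conds \<rho> ! j))" "constr_term R (snd (conds \<rho> ! j))"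
    "linear (snd (conds \<rho> ! j))" if "j < length (conds \<rho>)" for j
    using 1(3,5) 2(2) nth[OF that] by blast+
  have "(\<Union>(a, b)\<in>set (conds \<rho>). vars b) = (\<Union>j<length (conds \<rho>). vars (snd (conds \<rho> ! j)))"
    by (auto simp: in_set_conv_nth split_beta) force+
  then show "vars (rhs \<rho>) \<subseteq> vars (lhs \<rho>) \<union> (\<Union>j<length (conds \<rho>). vars (snd (conds \<rho> ! j)))"
    using 1(6) by simp
  show "vars (fst (conds \<rho> ! i)) \<subseteq> vars (lhs \<rho>) \<union> (\<Union>j<i. vars (snd (conds \<rho> ! j)))"
    if "i < length (conds \<rho>)" for i
    using 1(7) that by (simp add: lessThan_def)
qed

text \<open>A variable unifies with anything after renaming apart, so both terms have root symbols.
  If these differ, the anti-pattern only records the root of \<open>u\<close>; if they agree,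
  linearity moves the clash into one argument. The prefix \<open>p\<close> is arbitrary because the
  recursion names the variables inside that argument with a longer prefix.\<close>

lemma mismatch_AP:
  assumes "constr_term R b" "wf ar b" "linear b" "lnf R u" "linear u" "good (subst \<tau> u)"
    "\<not> unifiable (erase u) b"
  shows "\<exists>v. isAP R ar p b v \<and>
    (\<forall>\<theta>. (\<forall>q. \<theta> (AV (p @ q)) = subt (zeta (subst \<tau> u)) q) \<longrightarrow> subst \<theta> v = zeta (subst \<tau> u))"
  using assms
proof (induction b arbitrary: u p)
  case (Var x)
  have "subst Var (erase u) = subst (\<lambda>_. erase u) (Var x)" by (simp add: subst_Var)
  with Var.prems(7) show ?case unfolding unifiable_def by blast
next
  case (Fun f bs)
  show ?case
  proof (cases u)
    case (Var y)
    have "subst (\<lambda>_. Fun f bs) (erase u) = subst Var (Fun f bs)" using Var by (simp only: subst_Var) simp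
    with Fun.prems(7) show ?thesis unfolding unifiable_def by blast
  next
    case u: (Fun g us)
    from Fun.prems(6) have g: "lsym_ok R g" "length us = ar (esym g)"
      "\<And>i. i < length us \<Longrightarrow> good (subst \<tau> (us ! i))"
      by (auto simp: u)
    have f: "f \<notin> defs R" using Fun.prems(1) by (simp add: constr_term_def)
    show ?thesis
    proof (cases "esym g = f")
      case True
      \<comment> \<open>\<open>f\<close> is a constructor, so \<open>lsym_ok\<close> rules out
        \<open>LD f\<close> at the root of \<open>u\<close>.\<close>
      with g f have gf: "g = LC f" by (cases g) auto
      have len: "length us = length bs" using True g Fun.prems(2) by simp
      have lin: "distinct (concat (map vars_list us))" "distinct (concat (map vars_list bs))"
        using Fun.prems(3,5) by (auto simp: u linear_def)
      have "\<exists>i<length bs. \<not> unifiable (erase (us ! i)) (bs ! i)"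
      proof (rule ccontr)
        assume "\<not> ?thesis"
        then have "unifiable (Fun f (map erase us)) (Fun f bs)"
          using len lin by (intro unifiable_Fun) (auto simp: comp_def vars_list_erase)
        then show False using Fun.prems(7) by (simp add: u gf)
      qed
      then obtain i where i: "i < length bs" "\<not> unifiable (erase (us ! i)) (bs ! i)" by blast
      have "bs ! i \<in> set bs" "us ! i \<in> set us" using i len by auto
      with Fun.prems have "constr_term R (bs ! i)" "wf ar (bs ! i)" "lnf R (us ! i)"
        unfolding constr_term_def lnf_def u by auto
      then obtain v where v: "isAP R ar (p @ [Suc i]) (bs ! i) v"
        "\<And>\<theta>. (\<forall>q. \<theta> (AV ((p @ [Suc i]) @ q)) = subt (zeta (subst \<tau> (us ! i))) q) \<Longrightarrow>
          subst \<theta> v = zeta (subst \<tau> (us ! i))"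
        using Fun.IH[OF \<open>bs ! i \<in> set bs\<close>, of "us ! i" "p @ [Suc i]"] i len g(3)[of i] lin
        by (auto simp: linear_nth)
      let ?v = "Fun (HF f) (map (\<lambda>k. if k = Suc i then v else Var (AV (p @ [k]))) [1..<length bs + 1])"
      have "isAP R ar p (Fun f bs) ?v"
        using v(1) i by (intro isAP.ap_arg) auto
      moreover have "subst \<theta> ?v = zeta (subst \<tau> u)"
        if \<theta>: "\<forall>q. \<theta> (AV (p @ q)) = subt (zeta (subst \<tau> u)) q" for \<theta>
      proof -
        \<comment> \<open>Reading at \<open>Suc k # q\<close> is reading at \<open>q\<close> in
          argument \<open>k\<close>. This gives the hypothesis of \<open>v(2)\<close> for
          \<open>k = i\<close>, and the values of the plain variables for
          \<open>q = []\<close>.\<close>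
        have "\<theta> (AV (p @ Suc k # q)) = subt (zeta (subst \<tau> (us ! k))) q" if "k < length us" for k q
          using \<theta> that by (simp add: u gf subt_def)
        with v(2)[of \<theta>] show ?thesis
          using len i by (auto simp: u gf subt_def intro!: nth_equalityI simp del: upt_Suc)
      qed
      ultimately show ?thesis by blast
    next
      case False
      show ?thesis
      proof (cases g)
        case (LC c)
        have "isAP R ar p (Fun f bs) (Fun (HF c) (map (\<lambda>k. Var (AV (p @ [k]))) [1..<ar c + 1]))"
          using LC g False by (intro isAP.ap_con) auto
        moreover have "subst \<theta> (Fun (HF c) (map (\<lambda>k. Var (AV (p @ [k]))) [1..<ar c + 1])) = zeta (subst \<tau> u)"
          if \<theta>: "\<forall>q. \<theta> (AV (p @ q)) = subt (zeta (subst \<tau> u)) q" for \<theta>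
          using g(2) \<theta> by (auto simp: u LC subt_def intro!: nth_equalityI simp del: upt_Suc)
        ultimately show ?thesis by blast
      next
        case (LD h S)
        \<comment> \<open>A defined symbol in a labeled normal form has the empty label; its flags
          are all \<open>HBot\<close>, as in the anti-pattern.\<close>
        then have S: "S = {}" using Fun.prems(4) by (auto simp: lnf_def u)
        have "isAP R ar p (Fun f bs)
          (Fun (HF h) (map (\<lambda>k. Var (AV (p @ [k]))) [1..<ar h + 1] @ replicate (mR R h) (Fun HBot [])))"
          using LD g by (intro isAP.ap_def) auto
        moreover have "subst \<theta> (Fun (HF h) (map (\<lambda>k. Var (AV (p @ [k]))) [1..<ar h + 1] @
          replicate (mR R h) (Fun HBot []))) = zeta (subst \<tau> u)"
          if \<theta>: "\<forall>q. \<theta> (AV (p @ q)) = subt (zeta (subst \<tau> u)) q" for \<theta>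
        proof -
          have "map (\<lambda>k. \<theta> (AV (p @ [k]))) [1..<ar h + 1] = map (\<lambda>u. zeta (subst \<tau> u)) us"
            using g(2) \<theta> by (auto simp: u LD subt_def nth_append intro!: nth_equalityI simp del: upt_Suc)
          then show ?thesis by (simp add: u LD S flags_empty comp_def del: upt_Suc)
        qed
        ultimately show ?thesis by blast
      qed
    qed
  qed
qed

text \<open>A variable whose value contains defined symbols sits at an active position of the left-hand
  side or of an earlier condition, so usability makes it active in \<open>t\<close>.\<close>
lemma good_instance:
  assumes \<rho>: "\<rho> \<in> R" "lhs \<rho> = Fun f ls"
    and gd: "good (Fun (LD f S) (map (\<lambda>l. subst \<sigma> (label R l)) ls))"
    and m: "m \<le> length (conds \<rho>)"
    and bs: "\<And>j. j < m \<Longrightarrow> good (subst \<sigma> (label R (snd (conds \<rho> ! j))))"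
    and t: "t = (if m = length (conds \<rho>) then rhs \<rho> else fst (conds \<rho> ! m))"
  shows "good (subst \<sigma> (label R t))"
proof -
  \<comment> \<open>Numbering as in \<open>usable\<close>: index 0 is the left-hand side and index
    \<open>Suc j\<close> the condition with list index \<open>j\<close>. The term \<open>t\<close>
    then has index \<open>m + 1\<close>.\<close>
  let ?B = "\<lambda>j. if j = 0 then lhs \<rho> else snd (conds \<rho> ! (j - 1))"
  have f: "f \<in> defs R" using \<rho> by (force simp: defs_def)
  have gB: "good (subst \<sigma> (label R (?B j)))" if "j < m + 1" for j
    using that bs[of "j - 1"] gd f by (cases "j = 0") (auto simp: \<rho>(2) comp_def)
  have vars: "\<exists>j<m + 1. x \<in> vars (?B j)" if "x \<in> vars t" for x
  proof -
    have "vars t \<subseteq> vars (lhs \<rho>) \<union> (\<Union>j<m. vars (snd (conds \<rho> ! j)))"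
      using rule_props(9,10)[OF \<rho>] m unfolding t by auto
    with that consider "x \<in> vars (?B 0)" | j where "j < m" "x \<in> vars (?B (Suc j))" by auto
    then show ?thesis
    proof cases
      case 1
      then show ?thesis by (intro exI[of _ 0]) simp
    next
      case (2 j)
      then show ?thesis by (intro exI[of _ "Suc j"]) simp
    qed
  qed
  have act: "\<exists>j q. j < m + 1 \<and> subt_at (?B j) q = Some (Var x) \<and> good (\<sigma> x) \<and>
      (cfree (\<sigma> x) \<or> active ups (?B j) q)" if "x \<in> vars t" for x
  proof -
    from vars[OF that] obtain j where j: "j < m + 1" "x \<in> vars (?B j)" by blast
    from var_position[OF j(2)] obtain q where q: "subt_at (?B j) q = Some (Var x)" by blast
    from good_subst_label_var[OF gB[OF j(1)] q] j(1) q show ?thesis by blast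
  qed
  have us: "active ups t p" if "subt_at t p = Some s"
    "(\<exists>g ts. s = Fun g ts \<and> g \<in> defs R) \<or>
     (\<exists>x. s = Var x \<and> (\<exists>j q. j < m + 1 \<and> active ups (?B j) q \<and> subt (?B j) q = Var x))" for p s
  proof -
    have "t = (if m + 1 = length (conds \<rho>) + 1 then rhs \<rho> else fst (conds \<rho> ! (m + 1 - 1)))"
      using t by simp
    moreover have "p \<in> poss t" "subt t p = s" using that(1) by (auto simp: poss_def subt_def)
    ultimately show ?thesis
      using usable[unfolded usable_def Let_def, rule_format, OF \<rho>(1), of "m + 1" p] that(2) m
      by auto
  qed
  show ?thesis
  proof (rule good_subst_label)
    show "wf ar t" using rule_props[OF \<rho>] m by (auto simp: t)
    show "good (\<sigma> x)" if "x \<in> vars t" for x using act[OF that] by blast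
    show "active ups t p" if "subt_at t p = Some (Fun g ts)" "g \<in> defs R" for p g ts
      using us[OF that(1)] that(2) by blast
    show "active ups t p" if p: "subt_at t p = Some (Var x)" and x: "\<not> cfree (\<sigma> x)" for p x
    proof -
      from p have "x \<in> vars t"
        by (induction t p rule: subt_at.induct) (auto simp: vars_Var vars_Fun split: if_splits)
      from act[OF this] x obtain j q where "j < m + 1" "subt_at (?B j) q = Some (Var x)"
        "active ups (?B j) q" by blast
      then show ?thesis by (intro us[OF p] disjI2) (auto simp: subt_def intro!: exI[of _ j] exI[of _ q])
    qed
  qed
qed

text \<open>The invariant travels along the conditions: by strong induction the left-hand sides
  before \<open>m\<close> are good, the last assumption makes their right-hand sides good, and
  \<open>good_instance\<close> gives the next term.\<close>

lemma good_conditions: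
  assumes \<rho>: "\<rho> \<in> R" "lhs \<rho> = Fun f ls"
    and gd: "good (Fun (LD f S) (map (\<lambda>l. subst \<sigma> (label R l)) ls))"
    and "m \<le> length (conds \<rho>)"
    and IH: "\<And>j. j < m \<Longrightarrow> good (subst \<sigma> (label R (fst (conds \<rho> ! j)))) \<Longrightarrow>
      good (subst \<sigma> (label R (snd (conds \<rho> ! j))))"
  shows "good (subst \<sigma> (label R (if m = length (conds \<rho>) then rhs \<rho> else fst (conds \<rho> ! m))))"
  using assms(4) IH
proof (induction m rule: less_induct)
  case (less m)
  have "good (subst \<sigma> (label R (snd (conds \<rho> ! j))))" if "j < m" for j
    using less.IH[of j] that less.prems by auto
  then show ?case using good_instance[OF \<rho> gd less.prems(1)] by blast
qed

text \<open>Simulation of the single conditions is an assumption, since it is an induction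
  hypothesis in \<open>simulate_step\<close> but a proved fact in \<open>simulate_cond_step\<close>.
  Condition \<open>j\<close> is set up but not evaluated: what follows differs between success,
  failure and a step into the condition.\<close>

lemma simulate_conditions:
  assumes \<rho>: "\<rho> \<in> S" "lhs \<rho> = Fun f ls"
    and gd: "good (Fun (LD f S) (map (\<lambda>l. subst \<sigma> (label R l)) ls))"
    and j: "j < length (conds \<rho>)"
    and IH: "\<And>m. m < j \<Longrightarrow> good (subst \<sigma> (label R (fst (conds \<rho> ! m)))) \<Longrightarrow>
      good (subst \<sigma> (label R (snd (conds \<rho> ! m)))) \<and>
      hsteps (ev \<sigma> (fst (conds \<rho> ! m))) (ev \<sigma> (snd (conds \<rho> ! m))) (c m)"
    and i: "1 \<le> i" "i \<le> mR R f" "\<rho> = enum f i"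
  shows "good (subst \<sigma> (label R (fst (conds \<rho> ! j))))"
    "hplus (zeta (Fun (LD f S) (map (\<lambda>l. subst \<sigma> (label R l)) ls)))
      (Fun (HC f i (Suc j)) (map (ev \<sigma>) ls @ rep (flags f S) i
        (map (\<lambda>m. ev \<sigma> (snd (conds \<rho> ! m))) [0..<j] @ [ev \<sigma> (fst (conds \<rho> ! j))])))
      (sum_list (map c [0..<j]))"
proof -
  from \<rho>(1) gd have R: "\<rho> \<in> R" by (auto simp: restr_def)
  have a: "good (subst \<sigma> (label R (fst (conds \<rho> ! m))))" if "m \<le> j" for m
    using good_conditions[OF R \<rho>(2) gd, of m] that j IH by auto
  then show "good (subst \<sigma> (label R (fst (conds \<rho> ! j))))" by blast
  have "length ls = ar f" using gd by simp
  moreover have "hsteps (ev \<sigma> (fst (conds (enum f i) ! m))) (ev \<sigma> (snd (conds (enum f i) ! m))) (c m)"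
    if "m < j" for m
    using IH[OF that] a[of m] that i(3) by simp
  ultimately have "hplus (Fun (HF f) (map (ev \<sigma>) ls @ rep (flags f S) i [Fun HTop []]))
      (Fun (HC f i (Suc j)) (map (ev \<sigma>) ls @ rep (flags f S) i
        (map (\<lambda>m. ev \<sigma> (snd (conds \<rho> ! m))) [0..<j] @ [ev \<sigma> (fst (conds \<rho> ! j))])))
      (sum_list (map c [0..<j]))"
    using evaluate_conditions[OF i(1,2), of ls "flags f S" j \<sigma> c] \<rho>(2) i(3) j by simp
  then show "hplus (zeta (Fun (LD f S) (map (\<lambda>l. subst \<sigma> (label R l)) ls)))
      (Fun (HC f i (Suc j)) (map (ev \<sigma>) ls @ rep (flags f S) i
        (map (\<lambda>m. ev \<sigma> (snd (conds \<rho> ! m))) [0..<j] @ [ev \<sigma> (fst (conds \<rho> ! j))])))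
      (sum_list (map c [0..<j]))"
    using rep_flags_top[of f i S] \<rho>(1) i by (simp add: comp_def)
qed

section \<open>Simulation of labeled steps\<close>

lemma simulate_at:
  assumes "good s" "p \<in> poss s" "subt s p = r" "\<not> cfree r" "good r'" "hplus (zeta r) (zeta r') c"
  shows "good (replace_at s p r') \<and> hplus (zeta s) (zeta (replace_at s p r')) c"
proof -
  from assms(2,3) have "subt_at s p = Some r" by (simp add: poss_iff)
  note z = zeta_position[OF assms(1) this assms(4)]
  show ?thesis using z(4)[OF assms(5)] xplus_at[OF assms(6) z(1,2)] z(3)[of r'] by simp
qed

text \<open>Linearity of \<open>us\<close> and of the left-hand side confines the clash to one
  argument, whose anti-pattern triggers the free rule that sets flag \<open>i\<close> to
  \<open>HBot\<close>.\<close>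

lemma simulate_bot:
  assumes gd: "good (Fun (LD f S) ss)" and \<rho>: "\<rho> \<in> S" "lhs \<rho> = Fun f ls"
    and us: "length us = length ss" "\<forall>u\<in>set us. lnf R u" "distinct (concat (map vars_list us))"
      "ss = map (subst \<sigma>) us" "\<not> unifiable (Fun f (map erase us)) (lhs \<rho>)"
  shows "hplus (zeta (Fun (LD f S) ss)) (zeta (Fun (LD f (S - {\<rho>})) ss)) 0"
proof -
  from gd \<rho>(1) have "\<rho> \<in> restr R f" "\<rho> \<in> R" by (auto simp: restr_def)
  note props = rule_props[OF \<open>\<rho> \<in> R\<close> \<rho>(2)]
  obtain i where i: "1 \<le> i" "i \<le> mR R f" "\<rho> = enum f i"
    using obtain_enum[OF \<open>\<rho> \<in> restr R f\<close>] by blast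
  have len: "length us = length ls" using gd props(1) us(1) by (simp add: \<rho>(2))
  have dist: "distinct (concat (map vars_list ls))" using props(3) by (simp add: \<rho>(2) linear_def)
  have "\<exists>j<length ls. \<not> unifiable (erase (us ! j)) (ls ! j)"
  proof (rule ccontr)
    assume "\<not> ?thesis"
    then have "unifiable (Fun f (map erase us)) (Fun f ls)"
      using len dist us(3) by (intro unifiable_Fun) (auto simp: comp_def vars_list_erase)
    then show False using us(5) \<rho>(2) by simp
  qed
  then obtain j where j: "j < length ls" "\<not> unifiable (erase (us ! j)) (ls ! j)" by blast
  let ?ys = "map zeta ss"
  have "wf ar (ls ! j)" using props(1) j by (simp add: \<rho>(2))
  moreover have "good (subst \<sigma> (us ! j))" using gd us(4) j len by auto
  ultimately obtain v where v: "isAP R ar [] (ls ! j) v"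
    "\<And>\<theta>. (\<forall>q. \<theta> (AV ([] @ q)) = subt (zeta (subst \<sigma> (us ! j))) q) \<Longrightarrow>
      subst \<theta> v = zeta (subst \<sigma> (us ! j))"
    using mismatch_AP[of "ls ! j" "us ! j" \<sigma> "[]"] j props(4) us(2,3) len dist linear_nth
    by (metis nth_mem)
  have yj: "?ys ! j = zeta (subst \<sigma> (us ! j))" using us(4) j len by simp
  have "hstep (Fun (HF f) (?ys @ rep (flags f S) i [Fun HTop []]))
    (Fun (HF f) (?ys @ rep (flags f S) i [Fun HBot []])) 0"
    using \<rho>(2) i us(4) len v(1) j(1)
    by (intro bottom_step[OF i(1,2), of ls _ j v]) (auto simp: yj intro!: v(2))
  then show ?thesis
    using rep_flags_top[of f i S] rep_flags_bot[OF i(1,2), of S] \<rho>(1) i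
    by (intro xstep_imp_xplus) simp
qed

lemma sum_list_nth: "sum_list (map ((!) ds) [0..<length ds]) = sum_list ds"
  by (simp add: map_nth)

text \<open>Steps and condition reductions depend on each other, hence a mutual induction.
  \<open>good s\<close> stays inside the conclusion because the left-hand side of a condition is
  known to be good only after the earlier conditions have been treated.\<close>

lemma simulate_step: "ccstep R s t c \<Longrightarrow> good s \<longrightarrow> good t \<and> hplus (zeta s) (zeta t) c"
  and simulate_steps: "ccsteps R s t c \<Longrightarrow> good s \<longrightarrow> good t \<and> hsteps (zeta s) (zeta t) c"
proof (induct rule: ccstep_ccsteps.inducts)
  case (bot p s f Rl ss \<rho> ls us \<sigma>)
  show ?case
  proof
    assume s: "good s"
    have "subt_at s p = Some (Fun (LD f Rl) ss)" using bot(1,2) by (simp add: poss_iff)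
    then have gd: "good (Fun (LD f Rl) ss)" by (rule good_subt[OF s])
    show "good (replace_at s p (Fun (LD f (Rl - {\<rho>})) ss)) \<and>
        hplus (zeta s) (zeta (replace_at s p (Fun (LD f (Rl - {\<rho>})) ss))) 0"
      using simulate_bot[OF gd bot(3-9)] good_mono[OF gd, of "Rl - {\<rho>}"]
      by (intro simulate_at[OF s bot(1,2)]) auto
  qed
next
  case (succ p s f Rl \<sigma> ls \<rho> ds)
  let ?r = "Fun (LD f Rl) (map (\<lambda>l. subst \<sigma> (label R l)) ls)"
  let ?k = "length (conds \<rho>)"
  show ?case
  proof
    assume s: "good s"
    have "subt_at s p = Some (?r)" using succ(1,2) by (simp add: poss_iff)
    then have gd: "good (?r)" by (rule good_subt[OF s])
    then have \<rho>: "\<rho> \<in> restr R f" "\<rho> \<in> R" using succ(3) by (auto simp: restr_def)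
    obtain i where i: "1 \<le> i" "i \<le> mR R f" "\<rho> = enum f i" using obtain_enum[OF \<rho>(1)] by blast
    have lhs: "lhs (enum f i) = Fun f ls" using succ(4) i(3) by simp
    have IH: "good (subst \<sigma> (label R (snd (conds \<rho> ! m)))) \<and>
        hsteps (ev \<sigma> (fst (conds \<rho> ! m))) (ev \<sigma> (snd (conds \<rho> ! m))) (ds ! m)"
      if "m < ?k" "good (subst \<sigma> (label R (fst (conds \<rho> ! m))))" for m
      using succ(6) that by blast
    have "good (subst \<sigma> (label R (rhs \<rho>)))"
      using good_conditions[OF \<rho>(2) succ(4) gd, of ?k] IH by auto
    moreover have "hplus (zeta ?r) (ev \<sigma> (rhs \<rho>)) (Suc (sum_list ds))"
    proof (cases "conds \<rho> = []")
      case True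
      then have "hstep (zeta ?r) (ev \<sigma> (rhs \<rho>)) 1"
        using start_unconditional[OF i(1,2) lhs, of "flags f Rl" \<sigma>] rep_flags_top[of f i Rl] succ(3) i
        by (simp add: comp_def)
      with True succ(5) show ?thesis by (intro xstep_imp_xplus) simp
    next
      case False
      \<comment> \<open>\<open>j\<close> is the last condition: \<open>simulate_conditions\<close>
        covers the earlier ones, and this one is evaluated separately before the concluding
        rule.\<close>
      then obtain j where j: "?k = Suc j" by (cases ?k) auto
      have IH': "good (subst \<sigma> (label R (snd (conds \<rho> ! m)))) \<and>
          hsteps (ev \<sigma> (fst (conds \<rho> ! m))) (ev \<sigma> (snd (conds \<rho> ! m))) (ds ! m)"
        if "m < j" "good (subst \<sigma> (label R (fst (conds \<rho> ! m))))" for m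
        using IH[of m] that j by simp
      have jk: "j < ?k" using j by simp
      note 1 = simulate_conditions[OF succ(3,4) gd jk IH' i, simplified]
      have len: "length ls = ar f" using gd by simp
      have lenF: "length (flags f Rl) = mR R f" by simp
      have "hsteps (ev \<sigma> (fst (conds \<rho> ! j))) (ev \<sigma> (snd (conds \<rho> ! j))) (ds ! j)"
        using IH[OF jk] 1(1) by blast
      from condition_reduction[OF i(1,2) lhs lenF len this, where \<sigma> = \<sigma> and j = j]
      have 2: "hsteps (Fun (HC f i (Suc j)) (map (ev \<sigma>) ls @ rep (flags f Rl) i
          (map (\<lambda>m. ev \<sigma> (snd (conds \<rho> ! m))) [0..<j] @ [ev \<sigma> (fst (conds \<rho> ! j))])))
        (Fun (HC f i ?k) (map (ev \<sigma>) ls @ rep (flags f Rl) i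
          (map (\<lambda>m. ev \<sigma> (snd (conds \<rho> ! m))) [0..<?k]))) (ds ! j)"
        by (simp add: i(3)[symmetric] j)
      \<comment> \<open>The concluding rule has cost 1, which is the \<open>Suc\<close> in the cost
        of a successful step.\<close>
      have 3: "hstep (Fun (HC f i ?k) (map (ev \<sigma>) ls @ rep (flags f Rl) i
          (map (\<lambda>m. ev \<sigma> (snd (conds \<rho> ! m))) [0..<?k]))) (ev \<sigma> (rhs \<rho>)) 1"
        using finish_conditional[OF i(1,2) lhs lenF, where \<sigma> = \<sigma>] False by (simp add: i(3)[symmetric])
      have "sum_list ds = sum_list (map ((!) ds) [0..<j]) + ds ! j"
        using sum_list_nth[of ds] succ(5) j by simp
      with xplus_xsteps[OF xplus_xsteps[OF 1(2) 2] xstep_imp_xsteps[OF 3]] show ?thesis by simp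
    qed
    ultimately show "good (replace_at s p (subst \<sigma> (label R (rhs \<rho>)))) \<and>
      hplus (zeta s) (zeta (replace_at s p (subst \<sigma> (label R (rhs \<rho>))))) (Suc (sum_list ds))"
      by (intro simulate_at[OF s succ(1,2)]) auto
  qed
next
  case (fail p s f Rl \<sigma> ls \<rho> j ds \<tau> u c)
  let ?r = "Fun (LD f Rl) (map (\<lambda>l. subst \<sigma> (label R l)) ls)"
  let ?r' = "Fun (LD f (Rl - {\<rho>})) (map (\<lambda>l. subst \<sigma> (label R l)) ls)"
  show ?case
  proof
    assume s: "good s"
    have "subt_at s p = Some (?r)" using fail(1,2) by (simp add: poss_iff)
    then have gd: "good (?r)" by (rule good_subt[OF s])
    then have \<rho>: "\<rho> \<in> restr R f" "\<rho> \<in> R" using fail(3) by (auto simp: restr_def)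
    obtain i where i: "1 \<le> i" "i \<le> mR R f" "\<rho> = enum f i" using obtain_enum[OF \<rho>(1)] by blast
    have lhs: "lhs (enum f i) = Fun f ls" using fail(4) i(3) by simp
    have IH: "good (subst \<sigma> (label R (snd (conds \<rho> ! m)))) \<and>
        hsteps (ev \<sigma> (fst (conds \<rho> ! m))) (ev \<sigma> (snd (conds \<rho> ! m))) (ds ! m)"
      if "m < j" "good (subst \<sigma> (label R (fst (conds \<rho> ! m))))" for m
      using fail(7) that by blast
    have len: "length ls = ar f" using gd by simp
    have lenF: "length (flags f Rl) = mR R f" by simp
    note 1 = simulate_conditions[OF fail(3,4) gd fail(5) IH i, simplified]
    let ?w = "zeta (subst \<tau> u)"
    have w: "good (subst \<tau> u)" "hsteps (ev \<sigma> (fst (conds \<rho> ! j))) ?w c"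
      using fail(9) 1(1) by blast+
    from condition_reduction[OF i(1,2) lhs lenF len w(2), where \<sigma> = \<sigma> and j = j]
    have 2: "hsteps (Fun (HC f i (Suc j)) (map (ev \<sigma>) ls @ rep (flags f Rl) i
          (map (\<lambda>m. ev \<sigma> (snd (conds \<rho> ! m))) [0..<j] @ [ev \<sigma> (fst (conds \<rho> ! j))])))
        (Fun (HC f i (Suc j)) (map (ev \<sigma>) ls @ rep (flags f Rl) i
          (map (\<lambda>m. ev \<sigma> (snd (conds \<rho> ! m))) [0..<j] @ [?w]))) c"
      by (simp add: i(3)[symmetric])
    note props = rule_props[OF \<rho>(2) fail(4)]
    \<comment> \<open>The value reached is an instance of the labeled normal form \<open>u\<close>,
      whose erasure clashes with the right-hand side, so an anti-pattern matches its
      translation.\<close>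
    obtain v where v: "isAP R ar [] (snd (conds \<rho> ! j)) v"
      "\<And>\<theta>. (\<forall>q. \<theta> (AV ([] @ q)) = subt ?w q) \<Longrightarrow> subst \<theta> v = ?w"
      using mismatch_AP[OF props(7)[OF fail(5)] props(6)[OF fail(5)] props(8)[OF fail(5)]
        fail(11,10) w(1) fail(12), of "[]"] by blast
    have "hstep (Fun (HC f i (Suc j)) (map (ev \<sigma>) ls @ rep (flags f Rl) i
          (map (\<lambda>m. ev \<sigma> (snd (conds \<rho> ! m))) [0..<j] @ [?w])))
        (Fun (HF f) (map (ev \<sigma>) ls @ rep (flags f Rl) i [Fun HBot []])) 0"
      using failed_condition[OF i(1,2) lhs lenF, where j = j and v = v and \<sigma> = \<sigma> and w = ?w] fail(5) v
      by (simp add: i(3)[symmetric])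
    \<comment> \<open>Writing \<open>HBot\<close> at flag \<open>i\<close> is exactly the label
      update of a failed step.\<close>
    moreover have "Fun (HF f) (map (ev \<sigma>) ls @ rep (flags f Rl) i [Fun HBot []]) = zeta ?r'"
      using rep_flags_bot[OF i(1,2), of Rl] by (simp add: i(3)[symmetric] comp_def)
    ultimately have 3: "hsteps (Fun (HC f i (Suc j)) (map (ev \<sigma>) ls @ rep (flags f Rl) i
          (map (\<lambda>m. ev \<sigma> (snd (conds \<rho> ! m))) [0..<j] @ [?w]))) (zeta ?r') 0"
      by (metis xstep_imp_xsteps)
    have "sum_list ds = sum_list (map ((!) ds) [0..<j])"
      using sum_list_nth[of ds] fail(6) by simp
    with xplus_xsteps[OF xplus_xsteps[OF 1(2) 2] 3]
    have "hplus (zeta ?r) (zeta ?r') (sum_list ds + c)" by simp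
    then show "good (replace_at s p ?r') \<and>
        hplus (zeta s) (zeta (replace_at s p ?r')) (sum_list ds + c)"
      using good_mono[OF gd, of "Rl - {\<rho>}"] by (intro simulate_at[OF s fail(1,2)]) auto
  qed
next
  case (refl s)
  show ?case by (simp add: xsteps.xrefl)
next
  case (trans s t c u d)
  then show ?case using xsteps_trans xplus_imp_xsteps by blast
qed

section \<open>Steps into conditions and infinite reductions\<close>

lemma simulate_cond_step:
  assumes s: "good s" and "cond_step R s t"
  shows "good t \<and> (\<exists>h p c. hplus (zeta s) h c \<and> subt_at h p = Some (zeta t) \<and> active \<nu> h p)"
proof -
  from assms(2) obtain p f Rl \<rho> ls \<sigma> j where
    p: "p \<in> poss s" "subt s p = Fun (LD f Rl) (map (\<lambda>l. subst \<sigma> (label R l)) ls)"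
    and \<rho>: "\<rho> \<in> Rl" "lhs \<rho> = Fun f ls" and j: "j < length (conds \<rho>)"
    and c: "\<forall>i < j. \<exists>c. ccsteps R (subst \<sigma> (label R (fst (conds \<rho> ! i))))
                               (subst \<sigma> (label R (snd (conds \<rho> ! i)))) c"
    and t: "t = subst \<sigma> (label R (fst (conds \<rho> ! j)))"
    unfolding cond_step_def by blast
  let ?r = "Fun (LD f Rl) (map (\<lambda>l. subst \<sigma> (label R l)) ls)"
  have pr: "subt_at s p = Some ?r" using p by (simp add: poss_iff)
  have gd: "good ?r" using good_subt[OF s pr] .
  then have "\<rho> \<in> restr R f" using \<rho>(1) by auto
  then obtain i where i: "1 \<le> i" "i \<le> mR R f" "\<rho> = enum f i" using obtain_enum by blast
  from c obtain C where C: "\<And>m. m < j \<Longrightarrow> ccsteps R (subst \<sigma> (label R (fst (conds \<rho> ! m))))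
      (subst \<sigma> (label R (snd (conds \<rho> ! m)))) (C m)"
    by metis
  have IH: "good (subst \<sigma> (label R (snd (conds \<rho> ! m)))) \<and>
      hsteps (ev \<sigma> (fst (conds \<rho> ! m))) (ev \<sigma> (snd (conds \<rho> ! m))) (C m)"
    if "m < j" "good (subst \<sigma> (label R (fst (conds \<rho> ! m))))" for m
    using simulate_steps[OF C[OF that(1)]] that(2) by blast
  let ?h = "Fun (HC f i (Suc j)) (map (ev \<sigma>) ls @ rep (flags f Rl) i
        (map (\<lambda>m. ev \<sigma> (snd (conds \<rho> ! m))) [0..<j] @ [ev \<sigma> (fst (conds \<rho> ! j))]))"
  note sim = simulate_conditions[OF \<rho> gd j IH i]
  \<comment> \<open>Before this argument stand \<open>ar f\<close> ordinary arguments,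
    \<open>i - 1\<close> flags and \<open>j\<close> evaluated right-hand sides; positions count from
    1.\<close>
  let ?q = "[ar f + i + j]"
  have "length ls = ar f" using gd by simp
  then have q: "subt_at ?h ?q = Some (zeta t)" "active \<nu> ?h ?q"
    using i(1,2) by (auto simp: rep_def t nth_append)
  note z = zeta_position[OF s pr]
  have "hplus (zeta s) (replace_at (zeta s) p ?h) (sum_list (map C [0..<j]))"
    using xplus_at[OF sim(2) z(1,2)] by simp
  moreover have "subt_at (replace_at (zeta s) p ?h) (p @ ?q) = Some (zeta t)"
    using subt_at_replace_at[OF z(1)] q(1) by (simp only: subt_at_append) simp
  moreover have "active \<nu> (replace_at (zeta s) p ?h) (p @ ?q)"
    using subt_at_replace_at[OF z(1)] active_replace_at[OF z(1,2)] q(2)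
    by (simp add: active_append)
  ultimately show ?thesis using sim(1) t by blast
qed

text \<open>A simulated step into a condition leaves its surroundings in place, so the constructed
  terms are in general not \<open>zeta (g n)\<close> itself but contain it at an active position.
  Each original step yields at least one new step, so the result is infinite.\<close>

lemma simulate_nontermination:
  assumes s: "good s" and "lnonterm R s"
  shows "\<exists>g. g 0 = zeta s \<and> (\<forall>n. \<exists>c. hstep (g n) (g (Suc n)) c)"
proof -
  from assms(2) obtain g where g: "g 0 = s"
    "\<And>n. (\<exists>c. ccstep R (g n) (g (Suc n)) c) \<or> cond_step R (g n) (g (Suc n))"
    unfolding lnonterm_def by blast
  have good: "good (g n)" for n
  proof (induction n)
    case (Suc n)
    then show ?case using g(2)[of n] simulate_step simulate_cond_step by blast
  qed (simp add: g s)
  have step: "\<exists>h p c. hplus (zeta (g n)) h c \<and> subt_at h p = Some (zeta (g (Suc n))) \<and> active \<nu> h p" for n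
    using g(2)[of n]
  proof
    assume "\<exists>c. ccstep R (g n) (g (Suc n)) c"
    then obtain c where "hplus (zeta (g n)) (zeta (g (Suc n))) c"
      using simulate_step good by blast
    then show ?thesis by (intro exI[of _ "zeta (g (Suc n))"] exI[of _ "[]"]) auto
  qed (use simulate_cond_step good in blast)
  let ?P = "\<lambda>n h. \<exists>p. subt_at h p = Some (zeta (g n)) \<and> active \<nu> h p"
  have "\<exists>f. \<forall>n. (?P n (f n) \<and> (n = 0 \<longrightarrow> f n = zeta s)) \<and>
    (\<lambda>h h'. \<exists>c. hstep h h' c)\<^sup>+\<^sup>+ (f n) (f (Suc n))"
  proof (rule dependent_nat_choice)
    show "\<exists>x. ?P 0 x \<and> (0 = (0::nat) \<longrightarrow> x = zeta s)"
      by (intro exI[of _ "zeta s"]) (auto simp: g intro: exI[of _ "[]"])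
  next
    fix h n
    assume "?P n h \<and> (n = 0 \<longrightarrow> h = zeta s)"
    then obtain p where p: "subt_at h p = Some (zeta (g n))" "active \<nu> h p" by blast
    obtain h' q c where h': "hplus (zeta (g n)) h' c" "subt_at h' q = Some (zeta (g (Suc n)))"
      "active \<nu> h' q" using step by blast
    let ?h = "replace_at h p h'"
    have "subt_at ?h (p @ q) = Some (zeta (g (Suc n)))" "active \<nu> ?h (p @ q)"
      using subt_at_replace_at[OF p(1)] active_replace_at[OF p] h'(2,3)
      by (auto simp: subt_at_append active_append)
    moreover have "(\<lambda>h h'. \<exists>c. hstep h h' c)\<^sup>+\<^sup>+ h ?h"
      using xplus_imp_tranclp[OF xplus_at[OF h'(1) p]] .
    ultimately show "\<exists>y. (?P (Suc n) y \<and> (Suc n = 0 \<longrightarrow> y = zeta s)) \<and>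
        (\<lambda>h h'. \<exists>c. hstep h h' c)\<^sup>+\<^sup>+ h y"
      by blast
  qed
  \<comment> \<open>Consecutive terms are linked by nonempty reductions, which remain to be unrolled
    into single steps.\<close>
  then obtain f where "f 0 = zeta s" "\<And>n. (\<lambda>h h'. \<exists>c. hstep h h' c)\<^sup>+\<^sup>+ (f n) (f (Suc n))"
    by blast
  then show ?thesis using infinite_chain_tranclp[of "\<lambda>h h'. \<exists>c. hstep h h' c" f] by auto
qed

section \<open>Comparison of the complexities\<close>

lemma dh_le_dhx:
  assumes "good s"
  shows "dh R s \<le> dhx ar R enum \<nu> (zeta s)"
  unfolding dh_def dhx_def
\<comment> \<open>Costs are preserved exactly and nontermination carries over, so each part of the
  set on the left is contained in its counterpart.\<close>
proof (rule Sup_subset_mono, rule Un_mono)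
  show "{enat c |c t. ccsteps R s t c} \<subseteq> {enat c |c t. hsteps (zeta s) t c}"
    using simulate_steps assms by blast
  show "(if lnonterm R s then {\<infinity>} else {}) \<subseteq>
    (if \<exists>g. g 0 = zeta s \<and> (\<forall>n. \<exists>c. hstep (g n) (g (Suc n)) c) then {\<infinity>} else {})"
    using simulate_nontermination[OF assms] by auto
qed

text \<open>Constructors carry no flags, so \<open>xi R HTop\<close> keeps the shape and the size of
  a constructor term.\<close>

lemma constr_term_xi:
  assumes "constr_term R t" "wf ar t" "ground t"
  shows "good (label R t)" "cfree (label R t)" "ground (xi R HTop t)"
    "wf (harity ar R) (xi R HTop t)" "hsize (xi R HTop t) = tsize t"
    "h \<in> funs (xi R HTop t) \<Longrightarrow> \<exists>c. h = HF c \<and> c \<notin> defs R"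
proof -
  have "good (label R t) \<and> cfree (label R t) \<and> ground (xi R HTop t) \<and>
    wf (harity ar R) (xi R HTop t) \<and> hsize (xi R HTop t) = tsize t \<and>
    (\<forall>h\<in>funs (xi R HTop t). \<exists>c. h = HF c \<and> c \<notin> defs R)"
    using assms
  proof (induction t)
    case (Var x)
    then show ?case by (simp add: ground_def vars_Var)
  next
    case (Fun f ts)
    then have f: "f \<notin> defs R" by (simp add: constr_term_def)
    have IH: "good (label R t) \<and> cfree (label R t) \<and> ground (xi R HTop t) \<and>
      wf (harity ar R) (xi R HTop t) \<and> hsize (xi R HTop t) = tsize t \<and>
      (\<forall>h\<in>funs (xi R HTop t). \<exists>c. h = HF c \<and> c \<notin> defs R)" if "t \<in> set ts" for t
      using Fun that by (auto simp: constr_term_def ground_def vars_Fun)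
    then have size: "map (hsize \<circ> xi R HTop) ts = map tsize ts" by simp
    then show ?case
      using IH f Fun.prems(2) by (auto simp: mR_constr ground_def vars_Fun size)
  qed
  then show "good (label R t)" "cfree (label R t)" "ground (xi R HTop t)"
    "wf (harity ar R) (xi R HTop t)" "hsize (xi R HTop t) = tsize t"
    "h \<in> funs (xi R HTop t) \<Longrightarrow> \<exists>c. h = HF c \<and> c \<notin> defs R"
    by blast+
qed

text \<open>The flags added at the root are \<open>HTop\<close>, which \<open>hsize\<close> does not
  count, so the start term keeps its size. Its arguments are \<open>cfree\<close>, hence it is good
  whichever arguments of the root are active.\<close>

lemma basic_xi:
  assumes "ground t" "basic ar R t"
  shows "good (label R t)" "zeta (label R t) = xi R HTop t" "hbasic ar R enum (xi R HTop t)"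
    "hsize (xi R HTop t) = tsize t"
proof -
  from assms(2) obtain f ts where t: "t = Fun f ts" "f \<in> defs R" "wf ar t"
    "\<And>u. u \<in> set ts \<Longrightarrow> constr_term R u"
    unfolding basic_def by blast
  have ts: "constr_term R u" "wf ar u" "ground u" if "u \<in> set ts" for u
    using t that assms(1) by (auto simp: ground_def vars_Fun)
  note sub = constr_term_xi[OF ts]
  show "good (label R t)" using t sub(1,2) by (auto simp: t)
  show "zeta (label R t) = xi R HTop t"
    using zeta_label[of Var Var t] by (simp add: subst_Var)
  have "map (hsize \<circ> xi R HTop) ts = map tsize ts" using sub(5) by simp
  then show "hsize (xi R HTop t) = tsize t" by (simp add: t(1) sum_list_replicate del: map_eq_conv)
  show "hbasic ar R enum (xi R HTop t)"
    unfolding hbasic_def using t sub(3,4,6)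
    by (auto simp: ground_def vars_Fun t(1))
qed

lemma crc_le_rc: "crc ar R n \<le> rc ar R enum \<nu> n"
  unfolding crc_def rc_def
proof (rule Sup_least, clarify)
  fix t :: "('f, 'v) trm"
  assume t: "ground t" "basic ar R t" "tsize t \<le> n"
  note b = basic_xi[OF t(1,2)]
  have "dh R (label R t) \<le> dhx ar R enum \<nu> (xi R HTop t)"
    using dh_le_dhx[OF b(1)] b(2) by simp
  also have "\<dots> \<le> Sup {dhx ar R enum \<nu> s |s. hbasic ar R enum s \<and> hsize s \<le> n}"
    using b(3,4) t(3) by (intro Sup_upper) auto
  finally show "dh R (label R t) \<le> Sup {dhx ar R enum \<nu> s |s. hbasic ar R enum s \<and> hsize s \<le> n}" .
qed

end

theorem theorem7:
  fixes ar :: "'f \<Rightarrow> nat"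
    and R :: "('f, 'v) crule set"
    and enum :: "'f \<Rightarrow> nat \<Rightarrow> ('f, 'v) crule"
    and ups :: "'f \<Rightarrow> nat set"
    and n :: nat
  assumes "infinite (UNIV :: 'v set)"
    and "strong_cctrs ar R"
    and "\<forall>f. bij_betw (enum f) {1..mR R f} (restr R f)"
    and "\<forall>f. ups f \<subseteq> {1..ar f}"
    and "usable R ups"
  shows "crc ar R n \<le> rc ar R enum (muups ar ups) n"
proof -
  interpret simulation ar R enum ups
    using assms by unfold_locales auto
  show ?thesis by (rule crc_le_rc)
qed

end
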